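(* Let $Z\sim\mathcal N(0,1)$ be a standard Gaussian random variable. For all $x\in\mathbb S^2$, $$d_W(T_{\ell;t}(x),Z)\le\left(\frac{\sqrt3}{2\pi^2}+\frac23\sqrt{\frac{3}{2\pi^3}}\right)\sqrt{\frac{\log\ell}{\nu_t}}+o\left(\sqrt{\frac{\log\ell}{\nu_t}}\right),$$ as $\ell\to\infty$ and $\nu_t\to\infty$ jointly.
   Context: Let $\mu$ be the Lebesgue (surface) measure on the unit sphere $\mathbb S^2\subset\mathbb R^3$, so $\mu(\mathbb S^2)=4\pi$. For $t>0$ let $\nu_t>0$ be the rate (with $\nu_t\to\infty$ as $t\to\infty$) and let $N_t$ be a Poisson random measure on $\mathbb S^2$ with intensity measure $\nu_t\,\mu$; that is, $N_t(A)$ is Poisson with mean $\nu_t\mu(A)$ for each Borel set $A$, and $N_t$ is independent on disjoint sets. Let $P_\ell(u)=\frac{1}{2^\ell\ell!}\frac{d^\ell}{du^\ell}(u^2-1)^\ell$ be the Legendre polynomial of degree $\ell$. The Poisson spherical random wave is $$T_{\ell;t}(x)=\frac{1}{\sqrt{\nu_t}}\int_{\mathbb S^2}\sqrt{\frac{2\ell+1}{4\pi}}\,P_\ell(\langle x,\xi\rangle)\,dN_t(\xi)=\frac1{\sqrt{\nu_t}}\sum_{k=1}^{N_t(\mathbb S^2)}\sqrt{\frac{2\ell+1}{4\pi}}\,P_\ell(\langle x,\xi_k\rangle),\qquad x\in\mathbb S^2,$$ where $\xi_k$ are the points charged by $N_t$. The Wasserstein distance between random variables $X,Y$ is $d_W(X,Y)=\sup_h|\mathbb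 E[h(X)]-\mathbb E[h(Y)]|$, the supremum being over all $h:\mathbb R\to\mathbb R$ that are Lipschitz with constant at most $1$. *)

theory Defs
  imports "HOL-Probability.Probability" "HOL-Computational_Algebra.Polynomial"
begin

unbundle lipschitz_syntax

text \<open>
  Surface measure on the unit sphere of \<open>\<real>\<^sup>3\<close>, as a measure on the Borel sets of the sphere:
  \<open>\<mu>(A) = 3 \<lambda>\<^sup>3 {r \<xi> | 0 < r \<le> 1, \<xi> \<in> A}\<close>. This is the surface measure because of integration in
  polar coordinates, \<open>\<lambda>\<^sup>3(d(r \<xi>)) = r\<^sup>2 dr \<mu>(d\<xi>)\<close>. The origin is removed since \<open>sgn 0 = 0\<close>
  is not on the sphere.
\<close>

definition sphere_measure :: "(real^3) measure" where
  "sphere_measure =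
     scale_measure 3
       (distr (restrict_space lborel (cball 0 1 - {0})) (restrict_space borel (sphere 0 1)) sgn)"

lemma space_sphere_measure: "space sphere_measure = sphere 0 1"
  by (simp add: sphere_measure_def space_scale_measure)

lemma sets_sphere_measure: "sets sphere_measure = sets (restrict_space borel (sphere 0 1))"
  by (simp add: sphere_measure_def)

lemma sgn_measurable_sphere:
  "sgn \<in> restrict_space lborel (cball 0 1 - {0}) \<rightarrow>\<^sub>M restrict_space borel (sphere (0::real^3) 1)"
proof (rule measurable_restrict_space2)
  show "sgn \<in> space (restrict_space lborel (cball 0 1 - {0})) \<rightarrow> sphere (0::real^3) 1"
    by (auto simp: space_restrict_space norm_sgn)
  have "(sgn :: real^3 \<Rightarrow> _) \<in> borel_measurable borel"
    unfolding sgn_div_norm by measurable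
  then show "(sgn :: real^3 \<Rightarrow> _) \<in> borel_measurable (restrict_space lborel (cball 0 1 - {0}))"
    by (intro measurable_restrict_space1) simp
qed

lemma emeasure_sphere_measure:
  assumes "A \<in> sets sphere_measure"
  shows "emeasure sphere_measure A = 3 * emeasure lborel {y \<in> cball 0 1 - {0}. sgn y \<in> A}"
proof -
  let ?R = "restrict_space lborel (cball 0 1 - {0 :: real^3})"
  have eq: "sgn -` A \<inter> space ?R = {y \<in> cball 0 1 - {0}. sgn y \<in> A}"
    by (auto simp: space_restrict_space)
  have "emeasure sphere_measure A = 3 * emeasure ?R (sgn -` A \<inter> space ?R)"
    using assms sgn_measurable_sphere
    by (simp add: sphere_measure_def sets_sphere_measure emeasure_distr)
  also have "\<dots> = 3 * emeasure lborel {y \<in> cball 0 1 - {0}. sgn y \<in> A}"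
    unfolding eq by (subst emeasure_restrict_space) auto
  finally show ?thesis .
qed

lemma emeasure_sphere_measure_space: "emeasure sphere_measure (sphere 0 1) = ennreal (4 * pi)"
proof -
  have "{y \<in> cball (0::real^3) 1 - {0}. sgn y \<in> sphere 0 1} = cball 0 1 - {0}"
    by (auto simp: norm_sgn)
  moreover have "sphere 0 1 \<in> sets sphere_measure"
    by (metis sets.top space_sphere_measure)
  ultimately have "emeasure sphere_measure (sphere 0 1)
      = 3 * emeasure lborel (cball (0::real^3) 1 - {0})"
    by (simp add: emeasure_sphere_measure)
  also have "emeasure lborel (cball (0::real^3) 1 - {0}) = emeasure lborel (cball (0::real^3) 1)"
    by (subst emeasure_Diff_null_set) (auto intro: finite_imp_null_set_lborel)
  also have "\<dots> = ennreal (4 / 3 * pi)"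
    by (simp add: emeasure_cball unit_ball_vol_3)
  also have "3 * \<dots> = ennreal (3 * (4 / 3 * pi))"
    by (subst ennreal_mult) auto
  finally show ?thesis by simp
qed

lemma emeasure_sphere_measure_orthogonal:
  assumes f: "orthogonal_transformation f" and A: "A \<in> sets sphere_measure"
    and fA: "f ` A \<in> sets sphere_measure"
  shows "emeasure sphere_measure (f ` A) = emeasure sphere_measure A"
proof -
  define C where "C A = {y \<in> cball (0::real^3) 1 - {0}. sgn y \<in> A}" for A
  have n: "norm (f y) = norm y" for y
    using f by (rule orthogonal_transformation_norm)
  have "linear f" "inj f" "surj f"
    using orthogonal_transformation_linear[OF f] orthogonal_transformation_inj[OF f]
      orthogonal_transformation_surj[OF f] by simp_all
  then have s: "sgn (f y) = f (sgn y)" for y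
    by (simp add: sgn_div_norm n linear_scale)
  have C: "C (f ` A) = f ` C A"
  proof (intro subset_antisym subsetI)
    fix y assume y: "y \<in> C (f ` A)"
    obtain z where z: "y = f z" using \<open>surj f\<close> by (metis surjD)
    from y have "f (sgn z) \<in> f ` A" "norm z \<le> 1" "z \<noteq> 0"
      using n[of z] by (auto simp: C_def z s)
    then show "y \<in> f ` C A"
      using \<open>inj f\<close> by (auto simp: C_def z inj_image_mem_iff)
  next
    fix y assume "y \<in> f ` C A"
    then obtain z where z: "y = f z" "z \<in> C A" by auto
    then show "y \<in> C (f ` A)"
      using n[of z] by (auto simp: C_def s)
  qed
  have meas: "C B \<in> sets lborel" if "B \<in> sets sphere_measure" for B
  proof -
    have "sgn -` B \<inter> space (restrict_space lborel (cball 0 1 - {0}))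
        \<in> sets (restrict_space lborel (cball (0::real^3) 1 - {0}))"
      using sgn_measurable_sphere that
      by (rule_tac measurable_sets) (auto simp: sets_sphere_measure)
    moreover have "sgn -` B \<inter> space (restrict_space lborel (cball 0 1 - {0})) = C B"
      by (auto simp: C_def space_restrict_space)
    ultimately show ?thesis
      by (simp add: sets_restrict_space_iff)
  qed
  have fin: "emeasure lborel (C B) < \<infinity>" for B
    by (rule order.strict_trans1[OF emeasure_mono[of _ "cball 0 1"]])
       (auto simp: C_def emeasure_cball)
  have lm: "C B \<in> lmeasurable" if "B \<in> sets sphere_measure" for B
    using meas[OF that] fin[of B] by (auto intro!: fmeasurableI simp: emeasure_completion)
  have "measure lebesgue (C (f ` A)) = measure lebesgue (C A)"
    unfolding C by (rule measure_orthogonal_image[OF f lm[OF A]])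
  then have "emeasure lborel (C (f ` A)) = emeasure lborel (C A)"
    using fin meas[OF A] meas[OF fA]
    by (auto simp: measure_completion emeasure_eq_ennreal_measure less_top)
  then show ?thesis
    using A fA by (simp add: emeasure_sphere_measure C_def)
qed

text \<open>Rodrigues' formula: \<open>[:- 1, 0, 1:]\<close> is the polynomial \<open>u\<^sup>2 - 1\<close>.\<close>

definition legendre :: "nat \<Rightarrow> real poly" where
  "legendre l = smult (1 / (2 ^ l * fact l)) ((pderiv ^^ l) ([:- 1, 0, 1:] ^ l))"

text \<open>
  \<open>N\<close> is a Poisson random measure on the measurable space of \<open>\<Lambda>\<close>, with intensity \<open>\<Lambda>\<close>, over the
  probability space \<open>M\<close>. The counts \<open>N \<omega> A\<close> are extended real; the Poisson law is imposed whenever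
  \<open>\<Lambda> A\<close> is finite (mean \<open>0\<close> included, where \<open>0 ^ 0 = 1\<close>).
\<close>

definition poisson_random_measure ::
    "'a measure \<Rightarrow> ('a \<Rightarrow> 'b measure) \<Rightarrow> 'b measure \<Rightarrow> bool" where
  "poisson_random_measure M N \<Lambda> \<longleftrightarrow>
     prob_space M \<and>
     (\<forall>\<omega>\<in>space M. sets (N \<omega>) = sets \<Lambda>) \<and>
     (\<forall>A\<in>sets \<Lambda>. (\<lambda>\<omega>. emeasure (N \<omega>) A) \<in> borel_measurable M) \<and>
     (\<forall>A\<in>sets \<Lambda>. emeasure \<Lambda> A < \<infinity> \<longrightarrow>
        (\<forall>k::nat. measure M {\<omega>\<in>space M. emeasure (N \<omega>) A = of_nat k}
                    = exp (- measure \<Lambda> A) * measure \<Lambda> A ^ k / fact k)) \<and>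
     (\<forall>(n::nat) A. A ` {..<n} \<subseteq> sets \<Lambda> \<and> disjoint_family_on A {..<n} \<longrightarrow>
        prob_space.indep_vars M (\<lambda>_. borel) (\<lambda>i \<omega>. emeasure (N \<omega>) (A i)) {..<n})"

text \<open>
  The Poisson spherical random wave of degree \<open>l\<close> driven by \<open>N\<close>, with rate \<open>\<nu>\<close>. Integration
  against \<open>N \<omega>\<close> is the sum over the points charged by \<open>N \<omega>\<close>.
\<close>

definition poisson_wave ::
    "real \<Rightarrow> ('a \<Rightarrow> (real^3) measure) \<Rightarrow> nat \<Rightarrow> real^3 \<Rightarrow> 'a \<Rightarrow> real" where
  "poisson_wave \<nu> N l x \<omega> =
     1 / sqrt \<nu> *
       (\<integral>\<xi>. sqrt ((2 * real l + 1) / (4 * pi)) * poly (legendre l) (x \<bullet> \<xi>) \<partial>N \<omega>)"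

text \<open>
  Wasserstein distance between real random variables, possibly on different probability spaces;
  meaningful for integrable \<open>X\<close> and \<open>Y\<close>. Extended real values keep the supremum honest when it is
  infinite.
\<close>

definition wasserstein_dist ::
    "'a measure \<Rightarrow> ('a \<Rightarrow> real) \<Rightarrow> 'b measure \<Rightarrow> ('b \<Rightarrow> real) \<Rightarrow> ereal" where
  "wasserstein_dist M X M' Y =
     (SUP h \<in> {h :: real \<Rightarrow> real. 1-lipschitz_on UNIV h}.
        ereal \<bar>(\<integral>\<omega>. h (X \<omega>) \<partial>M) - (\<integral>\<omega>. h (Y \<omega>) \<partial>M')\<bar>)"

end

theory Submission
  imports Defs "HOL-Real_Asymp.Real_Asymp"
begin

text \<open>
  Discretising the integrand along its level sets turns an integral against a Poisson random measure
  into a sum of independent scaled Poisson variables. For those, the identity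
  \<open>E[X g(X)] = r E[g(X + 1)]\<close> and Stein's equation give \<open>d\<^sub>W \<le> 6 \<integral>|f|\<^sup>3\<close> for centred \<open>f\<close> of unit variance.

  For the wave, Archimedes' theorem reduces the third moment to the integral of \<open>|P\<^sub>l|\<^sup>3\<close> over
  \<open>[-1, 1]\<close>. Sonin's argument gives \<open>(1 - u\<^sup>2)\<^sup>1\<^sup>/\<^sup>2 P\<^sub>l(u)\<^sup>2 \<le> 4 / (2 l + 1)\<close>, and since
  \<open>(1 - |u|)\<^sup>-\<^sup>3\<^sup>/\<^sup>4\<close> is integrable, the third moment is at most a constant times \<open>\<nu>\<^sup>-\<^sup>1\<^sup>/\<^sup>2\<close>, uniformly in \<open>l\<close>.
  This has no logarithm, so the whole bound fits into the remainder.
\<close>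

section \<open>Solutions of Stein's equation\<close>

text \<open>The Poisson measure is given only through its counts, their laws and their independence
  on disjoint sets. Its integrals are therefore reached through finite sums, and the discretised
  integrand has mean and variance that are only close to 0 and 1. For this reason the bound for sums
  carries a separate term for each of these two defects; both disappear as the level sets shrink.

  The third absolute moment is what avoids the logarithm. Sonin's bound controls the fourth power of
  \<open>P_l\<close> by \<open>(1 - u^2)^(-1)\<close>, which just fails to be integrable at the
  poles; the third power leaves the exponent -3/4.

  Only the order in \<open>l\<close> and the rate matters, so constants are chosen for short proofs.
  The factor 6 is half of 12, the bound on the second derivative of the Stein solution, and the
  final 96 is 6 times 16, a bound for the third moment times the root of the rate.\<close>

lemma gaussian_tail_bound:
  fixes F F' :: "real \<Rightarrow> real"
  assumes D: "\<And>y. 0 \<le> y \<Longrightarrow> (F has_real_derivative F' y) (at y)"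
    and B: "\<And>y. 0 \<le> y \<Longrightarrow> \<bar>F' y\<bar> \<le> (a * y + b) * exp (- y\<^sup>2 / 2)"
    and lim: "(F \<longlongrightarrow> 0) at_top" and b: "0 \<le> b" and x: "0 \<le> x"
  shows "\<bar>F x\<bar> \<le> exp (- x\<^sup>2 / 2) * (a + 2 * b / (1 + x))"
proof -
  \<comment> \<open>Integrating \<open>(a * t + b) * exp (- t^2 / 2)\<close> from \<open>y\<close>
    to infinity gives \<open>a * exp (- y^2 / 2)\<close> plus \<open>b\<close> times a Gaussian
    tail, and \<open>2 / (1 + y)\<close> dominates the Mills ratio. The function \<open>U\<close>
    dominates \<open>F\<close> because \<open>- U'\<close> dominates the absolute value of
    \<open>F'\<close> and both functions vanish at infinity. The decay \<open>1 / (1 + y)\<close> is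
    what later makes \<open>x * g' x\<close> bounded.\<close>
  define U where "U y = exp (- y\<^sup>2 / 2) * (a + 2 * b / (1 + y))" for y :: real
  define U' where "U' y = - (a * y + 2 * b * y / (1 + y) + 2 * b / (1 + y)\<^sup>2) * exp (- y\<^sup>2 / 2)"
    for y :: real
  have DU: "(U has_real_derivative U' y) (at y)" if "0 \<le> y" for y
  proof -
    have "1 + y \<noteq> 0" using that by simp
    then have "(U has_real_derivative (- y * exp (- y\<^sup>2 / 2)) * (a + 2 * b / (1 + y))
        + exp (- y\<^sup>2 / 2) * (- (2 * b) / (1 + y)\<^sup>2)) (at y)"
      unfolding U_def by (auto intro!: derivative_eq_intros simp: power2_eq_square)
    also have "(- y * exp (- y\<^sup>2 / 2)) * (a + 2 * b / (1 + y))
        + exp (- y\<^sup>2 / 2) * (- (2 * b) / (1 + y)\<^sup>2) = U' y"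
      unfolding U'_def by (simp add: algebra_simps)
    finally show ?thesis .
  qed
  have limU: "(U \<longlongrightarrow> 0) at_top"
    unfolding U_def by real_asymp
  have U': "\<bar>F' y\<bar> \<le> - U' y" if "0 \<le> y" for y
  proof -
    have "2 * y / (1 + y) + 2 / (1 + y)\<^sup>2 - 1 = (1 + y\<^sup>2) / (1 + y)\<^sup>2"
      using that by (simp add: divide_simps) (simp add: algebra_simps power2_eq_square)
    also have "\<dots> \<ge> 0" by simp
    finally have "1 \<le> 2 * y / (1 + y) + 2 / (1 + y)\<^sup>2" by simp
    from mult_left_mono[OF this b]
    have "a * y + b \<le> a * y + 2 * b * y / (1 + y) + 2 * b / (1 + y)\<^sup>2"
      by (simp add: algebra_simps)
    then have "(a * y + b) * exp (- y\<^sup>2 / 2)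
        \<le> (a * y + 2 * b * y / (1 + y) + 2 * b / (1 + y)\<^sup>2) * exp (- y\<^sup>2 / 2)"
      by (rule mult_right_mono) simp
    also have "\<dots> = - U' y"
      unfolding U'_def by (simp only: minus_mult_left minus_minus)
    finally have "(a * y + b) * exp (- y\<^sup>2 / 2) \<le> - U' y" .
    with B[OF that] show ?thesis by simp
  qed
  have nonneg: "0 \<le> V x" if "\<And>y. 0 \<le> y \<Longrightarrow> (V has_real_derivative V' y) (at y)"
    "\<And>y. 0 \<le> y \<Longrightarrow> V' y \<le> 0" "(V \<longlongrightarrow> 0) at_top" for V V' :: "real \<Rightarrow> real"
  proof (rule tendsto_upperbound[OF that(3)])
    show "\<forall>\<^sub>F y in at_top. V y \<le> V x"
      using eventually_ge_at_top[of x]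
    proof eventually_elim
      case (elim y)
      show ?case
        by (rule DERIV_nonpos_imp_nonincreasing[OF elim]) (meson order_trans that(1,2) x)
    qed
  qed simp
  have "0 \<le> U x - F x"
  proof (rule nonneg[of "\<lambda>y. U y - F y" "\<lambda>y. U' y - F' y"])
    show "((\<lambda>y. U y - F y) \<longlongrightarrow> 0) at_top" using tendsto_diff[OF limU lim] by simp
    show "U' y - F' y \<le> 0" if "0 \<le> y" for y using U'[OF that] by linarith
  qed (intro derivative_intros DU D)
  moreover have "0 \<le> U x + F x"
  proof (rule nonneg[of "\<lambda>y. U y + F y" "\<lambda>y. U' y + F' y"])
    show "((\<lambda>y. U y + F y) \<longlongrightarrow> 0) at_top" using tendsto_add[OF limU lim] by simp
    show "U' y + F' y \<le> 0" if "0 \<le> y" for y using U'[OF that] by linarith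
  qed (intro derivative_intros DU D)
  ultimately show ?thesis unfolding U_def by linarith
qed

lemma gaussian_tail_bound_abs:
  fixes F F' :: "real \<Rightarrow> real"
  assumes D: "\<And>y. (F has_real_derivative F' y) (at y)"
    and B: "\<And>y. \<bar>F' y\<bar> \<le> (a * \<bar>y\<bar> + b) * exp (- y\<^sup>2 / 2)"
    and lim: "(F \<longlongrightarrow> 0) at_top" "(F \<longlongrightarrow> 0) at_bot" and b: "0 \<le> b"
  shows "\<bar>F x\<bar> \<le> exp (- x\<^sup>2 / 2) * (a + 2 * b / (1 + \<bar>x\<bar>))"
proof (cases "0 \<le> x")
  case True
  have "\<bar>F x\<bar> \<le> exp (- x\<^sup>2 / 2) * (a + 2 * b / (1 + x))"
  proof (rule gaussian_tail_bound[of F F'])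
    show "\<bar>F' y\<bar> \<le> (a * y + b) * exp (- y\<^sup>2 / 2)" if "0 \<le> y" for y
      using B[of y] that by simp
  qed (use assms True in auto)
  with True show ?thesis by simp
next
  case False
  have "\<bar>F (- (- x))\<bar> \<le> exp (- (- x)\<^sup>2 / 2) * (a + 2 * b / (1 + (- x)))"
  proof (rule gaussian_tail_bound[of "\<lambda>y. F (- y)" "\<lambda>y. - F' (- y)"])
    fix y :: real assume "0 \<le> y"
    show "((\<lambda>y. F (- y)) has_real_derivative - F' (- y)) (at y)"
      using D[of "- y"] unfolding DERIV_mirror .
    show "\<bar>- F' (- y)\<bar> \<le> (a * y + b) * exp (- y\<^sup>2 / 2)"
      using B[of "- y"] \<open>0 \<le> y\<close> by simp
  next
    show "((\<lambda>y. F (- y)) \<longlongrightarrow> 0) at_top"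
      using lim(2) unfolding filterlim_at_bot_mirror .
  qed (use b False in auto)
  with False show ?thesis by simp
qed

lemma has_real_derivative_integral_atMost:
  fixes k :: "real \<Rightarrow> real"
  assumes "integrable lborel k" "continuous_on UNIV k"
  shows "((\<lambda>x. \<integral>y. indicator {..x} y * k y \<partial>lborel) has_real_derivative k x) (at x)"
proof -
  let ?F = "\<lambda>x. \<integral>y. indicator {..x} y * k y \<partial>lborel"
  have int: "integrable lborel (\<lambda>y. indicator A y * k y)" if "A \<in> sets borel" for A
    using integrable_mult_indicator[of A lborel k] assms that by simp
  \<comment> \<open>Cutting at \<open>x - 1\<close> leaves a constant and an integral over a compact
    interval, to which the fundamental theorem applies. The two indicators overlap in one point,
    hence the equality almost everywhere below.\<close>
  have split: "?F y = ?F (x - 1) + integral {x - 1..y} k" if "x - 1 \<le> y" for y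
  proof -
    have meas: "k \<in> borel_measurable borel"
      using assms(1) by (auto dest: borel_measurable_integrable)
    have "?F y = (\<integral>u. indicator {..x-1} u * k u + indicator {x-1..y} u * k u \<partial>lborel)"
    proof (rule integral_cong_AE)
      show "AE u in lborel. indicator {..y} u * k u
          = indicator {..x-1} u * k u + indicator {x-1..y} u * k u"
        using AE_lborel_singleton[of "x - 1"]
        by eventually_elim (use that in \<open>auto simp: indicator_def\<close>)
    qed (use meas in measurable)
    also have "\<dots> = ?F (x - 1) + (\<integral>u. indicator {x-1..y} u * k u \<partial>lborel)"
      by (intro Bochner_Integration.integral_add int) auto
    also have "(\<integral>u. indicator {x-1..y} u * k u \<partial>lborel) = integral {x-1..y} k"
    proof -
      have "set_integrable lborel {x-1..y} k"
        using int[of "{x-1..y}"] by (simp add: set_integrable_def)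
      from set_borel_integral_eq_integral(2)[OF this] show ?thesis
        by (simp add: set_lebesgue_integral_def)
    qed
    finally show ?thesis .
  qed
  have "((\<lambda>y. integral {x-1..y} k) has_real_derivative k x) (at x within {x-1..x+1})"
    by (rule integral_has_real_derivative) (use assms in \<open>auto intro: continuous_on_subset\<close>)
  then have "((\<lambda>y. integral {x-1..y} k) has_real_derivative k x) (at x)"
    using at_within_interior[of x "{x-1..x+1}"] by simp
  then have "((\<lambda>y. ?F (x-1) + integral {x-1..y} k) has_real_derivative k x) (at x)"
    by (auto intro!: derivative_eq_intros)
  then show ?thesis
    by (rule has_field_derivative_transform_within_open[where S="{x-1<..<x+1}"]) (auto intro!: split[symmetric])
qed

lemma tendsto_integral_atMost_at_bot:
  fixes k :: "real \<Rightarrow> real"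
  assumes "integrable lborel k"
  shows "((\<lambda>x. \<integral>y. indicator {..x} y * k y \<partial>lborel) \<longlongrightarrow> 0) at_bot"
proof -
  have "((\<lambda>x. \<integral>y. indicator {..- x} y * k y \<partial>lborel) \<longlongrightarrow> (\<integral>y. 0 \<partial>(lborel :: real measure))) at_top"
  proof (rule integral_dominated_convergence_at_top[where w="\<lambda>y. \<bar>k y\<bar>"])
    show "AE y in lborel. ((\<lambda>x. indicator {..- x} y * k y) \<longlongrightarrow> 0) at_top"
    proof (rule AE_I2)
      fix y :: real
      show "((\<lambda>x. indicator {..- x} y * k y) \<longlongrightarrow> 0) at_top"
        by (rule tendsto_eventually, rule eventually_mono[OF eventually_gt_at_top[of "- y"]])
           (auto simp: indicator_def)
    qed
  qed (use assms in \<open>auto simp: indicator_def\<close>)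
  then show ?thesis unfolding filterlim_at_bot_mirror by simp
qed

text \<open>The approximation is the average of \<open>h\<close> over an interval of length
  \<open>e\<close>, written as a difference quotient of an antiderivative. Smoothing is needed
  because the second derivative of the Stein solution contains the derivative of the test
  function.\<close>

lemma ex_smooth_lipschitz_approx:
  fixes h :: "real \<Rightarrow> real"
  assumes h: "1-lipschitz_on UNIV h" and e: "0 < e"
  obtains k k' where "\<And>x. (k has_real_derivative k' x) (at x)" "\<And>x. \<bar>k' x\<bar> \<le> 1"
    "\<And>x. \<bar>k x - h x\<bar> \<le> e"
proof -
  have lip: "\<bar>h x - h y\<bar> \<le> \<bar>x - y\<bar>" for x y
    using lipschitz_onD[OF h, of x y] by (simp add: dist_real_def)
  have "\<exists>H. \<forall>x. -\<infinity> < ereal x \<longrightarrow> ereal x < \<infinity> \<longrightarrow> (H has_vector_derivative h x) (at x)"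
    using lipschitz_on_continuous_on[OF h]
    by (intro einterval_antiderivative) (auto simp: continuous_on_eq_continuous_at)
  then obtain H where H: "(H has_real_derivative h x) (at x)" for x
    by (auto simp: has_real_derivative_iff_has_vector_derivative)
  define k where "k x = (H (x + e) - H x) / e" for x
  show ?thesis
  proof (rule that[of k "\<lambda>x. (h (x + e) - h x) / e"])
    fix x
    show "(k has_real_derivative (h (x + e) - h x) / e) (at x)"
    proof -
      have "((\<lambda>x. H (x + e)) has_real_derivative h (x + e)) (at x)"
        using H[of "x + e"] unfolding DERIV_shift .
      then show ?thesis
        unfolding k_def[abs_def] by (intro DERIV_cdivide DERIV_diff H)
    qed
    show "\<bar>(h (x + e) - h x) / e\<bar> \<le> 1"
      using lip[of "x + e" x] e by (simp add: field_simps)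
    obtain z where z: "x < z" "z < x + e" "H (x + e) - H x = (x + e - x) * h z"
      using MVT2[of x "x + e" H h] H e by auto
    then have "k x = h z" using e by (simp add: k_def)
    with lip[of z x] z show "\<bar>k x - h x\<bar> \<le> e" by simp
  qed
qed

text \<open>The constant 1 bounds the first absolute Gaussian moment:
  \<open>|z| \<le> 1 / 2 + z^2 / 2\<close>, and the second moment is 1. The linear growth is the
  input of the tail comparison with both coefficients equal to 1.\<close>

lemma std_normal_abs_diff_le:
  fixes h :: "real \<Rightarrow> real"
  assumes h: "1-lipschitz_on UNIV h"
  shows "integrable lborel (\<lambda>z. std_normal_density z * h z)"
    and "\<bar>h y - (\<integral>z. std_normal_density z * h z \<partial>lborel)\<bar> \<le> \<bar>y\<bar> + 1"
proof -
  have lip: "\<bar>h x - h y\<bar> \<le> \<bar>x - y\<bar>" for x y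
    using lipschitz_onD[OF h, of x y] by (simp add: dist_real_def)
  have cont: "continuous_on UNIV h"
    using lipschitz_on_continuous_on[OF h] .
  then have meas [measurable]: "h \<in> borel_measurable borel"
    by (rule borel_measurable_continuous_onI)
  have int0: "integrable lborel std_normal_density"
    using integrable_std_normal_moment[of 0] by simp
  have int1: "integrable lborel (\<lambda>z. std_normal_density z * \<bar>z\<bar>)"
    using integrable_std_normal_moment_abs[of 1] by simp
  have int2: "integrable lborel (\<lambda>z. std_normal_density z * z\<^sup>2)"
    using integrable_std_normal_moment[of 2] by simp
  show int: "integrable lborel (\<lambda>z. std_normal_density z * h z)"
  proof (rule Bochner_Integration.integrable_bound)
    show "integrable lborel (\<lambda>z. std_normal_density z * \<bar>h 0\<bar> + std_normal_density z * \<bar>z\<bar>)"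
      using int0 int1 by auto
    have "\<bar>h z\<bar> \<le> \<bar>h 0\<bar> + \<bar>z\<bar>" for z
      using lip[of z 0] by linarith
    then have "std_normal_density z * \<bar>h z\<bar> \<le> std_normal_density z * (\<bar>h 0\<bar> + \<bar>z\<bar>)" for z
      by (intro mult_left_mono) auto
    then show "AE z in lborel. norm (std_normal_density z * h z)
        \<le> norm (std_normal_density z * \<bar>h 0\<bar> + std_normal_density z * \<bar>z\<bar>)"
      by (simp add: abs_mult distrib_left)
  qed simp
  have mass: "(\<integral>z. std_normal_density z \<partial>lborel) = 1"
    using integral_std_normal_moment_even[of 0] by simp
  have "\<bar>h y - (\<integral>z. std_normal_density z * h z \<partial>lborel)\<bar>
      = \<bar>\<integral>z. std_normal_density z * h y - std_normal_density z * h z \<partial>lborel\<bar>"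
    using int int0 mass by simp
  also have "\<dots> \<le> (\<integral>z. std_normal_density z * (\<bar>y\<bar> + 1 / 2) + std_normal_density z * z\<^sup>2 * (1 / 2) \<partial>lborel)"
  proof (rule integral_abs_bound_integral)
    show "integrable lborel (\<lambda>z. std_normal_density z * h y - std_normal_density z * h z)"
      using int int0 by auto
    show "integrable lborel (\<lambda>z. std_normal_density z * (\<bar>y\<bar> + 1 / 2) + std_normal_density z * z\<^sup>2 * (1 / 2))"
      using int2 int0 by (intro Bochner_Integration.integrable_add integrable_mult_left) auto
    fix z :: real
    have "\<bar>z\<bar> \<le> 1 / 2 + z\<^sup>2 / 2"
      using sum_squares_bound[of "\<bar>z\<bar>" 1] by simp
    then have "\<bar>h y - h z\<bar> \<le> \<bar>y\<bar> + 1 / 2 + z\<^sup>2 * (1 / 2)"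
      using lip[of y z] by linarith
    then have "\<bar>std_normal_density z * (h y - h z)\<bar>
        \<le> std_normal_density z * (\<bar>y\<bar> + 1 / 2 + z\<^sup>2 * (1 / 2))"
      unfolding abs_mult by (simp add: mult_left_mono)
    then show "\<bar>std_normal_density z * h y - std_normal_density z * h z\<bar>
        \<le> std_normal_density z * (\<bar>y\<bar> + 1 / 2) + std_normal_density z * z\<^sup>2 * (1 / 2)"
      by (simp add: algebra_simps)
  qed
  also have "\<dots> = \<bar>y\<bar> + 1"
  proof -
    have "(\<integral>z. std_normal_density z * z\<^sup>2 \<partial>lborel) = fact 2 / (2 * fact 1)"
      using integral_std_normal_moment_even[of 1] unfolding mult_1_right power_one_right .
    also have "fact 2 / (2 * fact 1) = (1 :: real)"
      by (simp add: fact_2)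
    finally have moment2: "(\<integral>z. std_normal_density z * z\<^sup>2 \<partial>lborel) = 1" .
    have "(\<integral>z. std_normal_density z * (\<bar>y\<bar> + 1 / 2) + std_normal_density z * z\<^sup>2 * (1 / 2) \<partial>lborel)
        = (\<integral>z. std_normal_density z * (\<bar>y\<bar> + 1 / 2) \<partial>lborel)
          + (\<integral>z. std_normal_density z * z\<^sup>2 * (1 / 2) \<partial>lborel)"
      by (rule Bochner_Integration.integral_add[OF integrable_mult_left[OF int0] integrable_mult_left[OF int2]])
    also have "\<dots> = \<bar>y\<bar> + 1"
      unfolding integral_mult_left_zero moment2 mass by simp
    finally show ?thesis .
  qed
  finally show "\<bar>h y - (\<integral>z. std_normal_density z * h z \<partial>lborel)\<bar> \<le> \<bar>y\<bar> + 1" .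
qed

lemma lipschitz_on_of_derivative:
  fixes h h' :: "real \<Rightarrow> real"
  assumes D: "\<And>x. (h has_real_derivative h' x) (at x)" and h': "\<And>x. \<bar>h' x\<bar> \<le> 1"
  shows "1-lipschitz_on UNIV h"
proof (rule lipschitz_onI)
  fix x y :: real
  have "norm (h x - h y) \<le> 1 * norm (x - y)"
    by (rule field_differentiable_bound[of UNIV h h']) (use D h' in auto)
  then show "dist (h x) (h y) \<le> 1 * dist x y" by (simp add: dist_norm)
qed simp

text \<open>Variation of constants: \<open>g\<close> is \<open>exp (x^2 / 2)\<close> times the
  integral of \<open>(h - m) * exp (- y^2 / 2)\<close> up to \<open>x\<close>. One tail comparison
  bounds \<open>g\<close> by 1 + 2 = 3. A second one bounds \<open>g'\<close> by
  \<open>8 / (1 + |x|)\<close>, which also controls \<open>x * g'\<close>, so that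
  \<open>g'' = g + x * g' + h'\<close> is at most 3 + 8 + 1 = 12.\<close>

lemma stein_solution:
  fixes h h' :: "real \<Rightarrow> real"
  assumes D: "\<And>x. (h has_real_derivative h' x) (at x)" and h': "\<And>x. \<bar>h' x\<bar> \<le> 1"
  obtains g g' g'' where
    "\<And>x. (g has_real_derivative g' x) (at x)" "\<And>x. (g' has_real_derivative g'' x) (at x)"
    "\<And>x. g' x - x * g x = h x - (\<integral>z. std_normal_density z * h z \<partial>lborel)"
    "\<And>x. \<bar>g x\<bar> \<le> 3" "\<And>x. \<bar>g' x\<bar> \<le> 8" "\<And>x. \<bar>g'' x\<bar> \<le> 12"
proof -
  have h: "1-lipschitz_on UNIV h"
    by (rule lipschitz_on_of_derivative[OF D h'])
  define m where "m = (\<integral>z. std_normal_density z * h z \<partial>lborel)"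
  have hm: "\<bar>h y - m\<bar> \<le> \<bar>y\<bar> + 1" for y
    using std_normal_abs_diff_le(2)[OF h] by (simp add: m_def)
  define k where "k y = (h y - m) * exp (- y\<^sup>2 / 2)" for y
  have k_eq: "k y = sqrt (2 * pi) * (std_normal_density y * h y - m * std_normal_density y)" for y
    by (simp add: k_def std_normal_density_def field_simps)
  have int0: "integrable lborel std_normal_density"
    using integrable_std_normal_moment[of 0] by simp
  have int_k: "integrable lborel k"
    unfolding k_eq using std_normal_abs_diff_le(1)[OF h] int0 by auto
  have k_0: "(\<integral>y. k y \<partial>lborel) = 0"
    unfolding k_eq using std_normal_abs_diff_le(1)[OF h] int0 integral_std_normal_moment_even[of 0]
    by (simp add: m_def)
  have cont_k: "continuous_on UNIV k"
    unfolding k_def using lipschitz_on_continuous_on[OF h] by (intro continuous_intros) auto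
  have bound_k: "\<bar>k y\<bar> \<le> (1 * \<bar>y\<bar> + 1) * exp (- y\<^sup>2 / 2)" for y
    unfolding k_def using hm[of y] by (simp add: abs_mult mult_right_mono)
  define F where "F x = (\<integral>y. indicator {..x} y * k y \<partial>lborel)" for x
  have DF: "(F has_real_derivative k x) (at x)" for x
    unfolding F_def by (rule has_real_derivative_integral_atMost[OF int_k cont_k])
  have F: "\<bar>F x\<bar> \<le> exp (- x\<^sup>2 / 2) * (1 + 2 * 1 / (1 + \<bar>x\<bar>))" for x
  proof (rule gaussian_tail_bound_abs[OF DF bound_k])
    \<comment> \<open>The total integral of \<open>k\<close> is zero because \<open>m\<close> is the
      Gaussian mean of \<open>h\<close>. Without this centring \<open>g\<close> would grow like
      \<open>exp (x^2 / 2)\<close>.\<close>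
    show "(F \<longlongrightarrow> 0) at_top"
      using tendsto_integral_at_top[of lborel k] int_k k_0 unfolding F_def[abs_def] by simp
    show "(F \<longlongrightarrow> 0) at_bot"
      unfolding F_def by (rule tendsto_integral_atMost_at_bot[OF int_k])
  qed simp
  have F3: "\<bar>F x\<bar> \<le> exp (- x\<^sup>2 / 2) * 3" for x
  proof -
    have "1 + 2 * 1 / (1 + \<bar>x\<bar>) \<le> 3" by (simp add: divide_simps)
    then show ?thesis using F[of x] by (meson exp_ge_zero mult_left_mono order_trans)
  qed
  define g where "g x = F x * exp (x\<^sup>2 / 2)" for x
  have F_g: "F x = g x * exp (- x\<^sup>2 / 2)" for x
    by (simp add: g_def mult.assoc exp_minus divide_simps)
  have g3: "\<bar>g x\<bar> \<le> 3" for x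
    using F3[of x] unfolding F_g abs_mult by (simp add: mult.commute)
  define g' where "g' x = x * g x + (h x - m)" for x
  define g'' where "g'' x = g x + x * g' x + h' x" for x
  have Dg: "(g has_real_derivative g' x) (at x)" for x
  proof -
    have "(g has_real_derivative k x * exp (x\<^sup>2 / 2) + F x * (exp (x\<^sup>2 / 2) * x)) (at x)"
      unfolding g_def by (auto intro!: derivative_eq_intros DF)
    also have "k x * exp (x\<^sup>2 / 2) + F x * (exp (x\<^sup>2 / 2) * x) = g' x"
      by (simp add: g'_def g_def k_def mult.assoc exp_minus)
    finally show ?thesis .
  qed
  have Dg': "(g' has_real_derivative g'' x) (at x)" for x
    unfolding g'_def[abs_def] by (auto intro!: derivative_eq_intros Dg D simp: g''_def g'_def)
  \<comment> \<open>\<open>g'\<close> solves the Stein equation with right-hand side \<open>g + h'\<close>, which is bounded by \<open>4\<close>.\<close>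
  define F2 where "F2 x = g' x * exp (- x\<^sup>2 / 2)" for x
  have DF2: "(F2 has_real_derivative (g x + h' x) * exp (- x\<^sup>2 / 2)) (at x)" for x
    unfolding F2_def by (auto intro!: derivative_eq_intros Dg' simp: g''_def algebra_simps)
  have "\<bar>F2 x\<bar> \<le> exp (- x\<^sup>2 / 2) * (0 + 2 * 4 / (1 + \<bar>x\<bar>))" for x
  proof (rule gaussian_tail_bound_abs[OF DF2])
    show "\<bar>(g y + h' y) * exp (- y\<^sup>2 / 2)\<bar> \<le> (0 * \<bar>y\<bar> + 4) * exp (- y\<^sup>2 / 2)" for y
    proof -
      have "\<bar>g y + h' y\<bar> \<le> 4" using g3[of y] h'[of y] by linarith
      then show ?thesis by (simp add: abs_mult)
    qed
    \<comment> \<open>A rough linear bound on \<open>g'\<close>, enough to make \<open>F2\<close>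
      vanish at both ends; the comparison then turns growth into decay.\<close>
    have bound: "\<bar>F2 x\<bar> \<le> (4 * \<bar>x\<bar> + 1) * exp (- x\<^sup>2 / 2)" for x
    proof -
      have "\<bar>x * g x\<bar> \<le> \<bar>x\<bar> * 3" unfolding abs_mult by (intro mult_left_mono g3) simp
      then have "\<bar>g' x\<bar> \<le> 4 * \<bar>x\<bar> + 1" using hm[of x] by (simp add: g'_def)
      then show ?thesis by (simp add: F2_def abs_mult)
    qed
    show "(F2 \<longlongrightarrow> 0) at_top"
    proof (rule Lim_null_comparison)
      show "((\<lambda>x::real. (4 * \<bar>x\<bar> + 1) * exp (- x\<^sup>2 / 2)) \<longlongrightarrow> 0) at_top" by real_asymp
    qed (use bound in simp)
    show "(F2 \<longlongrightarrow> 0) at_bot"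
    proof (rule Lim_null_comparison)
      show "((\<lambda>x::real. (4 * \<bar>x\<bar> + 1) * exp (- x\<^sup>2 / 2)) \<longlongrightarrow> 0) at_bot" by real_asymp
    qed (use bound in simp)
  qed simp
  note F2 = this
  have g'_bound: "\<bar>g' x\<bar> \<le> 8 / (1 + \<bar>x\<bar>)" for x
  proof -
    have "\<bar>g' x\<bar> * exp (- x\<^sup>2 / 2) \<le> 8 / (1 + \<bar>x\<bar>) * exp (- x\<^sup>2 / 2)"
      using F2[of x] by (simp add: F2_def abs_mult mult.commute)
    then show ?thesis by (rule mult_right_le_imp_le) simp
  qed
  have xg': "\<bar>x * g' x\<bar> \<le> 8" and g8: "\<bar>g' x\<bar> \<le> 8" for x
  proof -
    have "\<bar>g' x\<bar> * (1 + \<bar>x\<bar>) \<le> 8"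
      using g'_bound[of x] by (simp add: pos_le_divide_eq)
    then have *: "\<bar>g' x\<bar> + \<bar>x * g' x\<bar> \<le> 8" by (simp add: abs_mult algebra_simps)
    then show "\<bar>x * g' x\<bar> \<le> 8" "\<bar>g' x\<bar> \<le> 8" by auto
  qed
  show ?thesis
  proof (rule that[OF Dg Dg' _ g3 g8])
    show "g' x - x * g x = h x - (\<integral>z. std_normal_density z * h z \<partial>lborel)" for x
      by (simp add: g'_def m_def)
    show "\<bar>g'' x\<bar> \<le> 12" for x
      using g3[of x] xg'[of x] h'[of x] unfolding g''_def by linarith
  qed
qed

section \<open>Normal approximation of sums of Poisson variables\<close>

lemma integral_abs_le_integral:
  fixes f g :: "'a \<Rightarrow> real"
  assumes "integrable M f" "integrable M g" "\<And>x. x \<in> space M \<Longrightarrow> \<bar>f x\<bar> \<le> g x"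
  shows "\<bar>\<integral>x. f x \<partial>M\<bar> \<le> (\<integral>x. g x \<partial>M)"
proof -
  have "\<bar>\<integral>x. f x \<partial>M\<bar> \<le> (\<integral>x. \<bar>f x\<bar> \<partial>M)" by (rule integral_abs_bound)
  also have "\<dots> \<le> (\<integral>x. g x \<partial>M)" by (intro integral_mono integrable_abs assms)
  finally show ?thesis .
qed

context prob_space
begin

lemma abs_expectation_le:
  fixes f :: "'a \<Rightarrow> real"
  assumes "integrable M f" "\<And>\<omega>. \<omega> \<in> space M \<Longrightarrow> \<bar>f \<omega>\<bar> \<le> c"
  shows "\<bar>expectation f\<bar> \<le> c"
  using integral_abs_le_integral[of M f "\<lambda>_. c"] assms by (simp add: prob_space)

definition has_poisson_counts :: "('a \<Rightarrow> real) \<Rightarrow> real \<Rightarrow> bool" where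
  "has_poisson_counts X r \<longleftrightarrow> random_variable borel X \<and> 0 \<le> r \<and>
     (\<forall>k::nat. prob {\<omega>\<in>space M. X \<omega> = real k} = exp (- r) * r ^ k / fact k)"

lemma poisson_weights_sums: "(\<lambda>k. exp (- r) * r ^ k / fact k) sums (1 :: real)"
proof -
  have "(\<lambda>k. exp (- r) * (r ^ k /\<^sub>R fact k)) sums (exp (- r) * exp r)"
    by (intro sums_mult exp_converges)
  then show ?thesis by (simp add: exp_minus divide_inverse mult_ac)
qed

lemma AE_has_poisson_counts:
  assumes "has_poisson_counts X r"
  shows "AE \<omega> in M. \<exists>k::nat. X \<omega> = real k"
proof -
  have [measurable]: "random_variable borel X" and
    p: "prob {\<omega>\<in>space M. X \<omega> = real k} = exp (- r) * r ^ k / fact k" for k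
    using assms by (auto simp: has_poisson_counts_def)
  have "(\<lambda>k. prob {\<omega>\<in>space M. X \<omega> = real k}) sums prob (\<Union>k. {\<omega>\<in>space M. X \<omega> = real k})"
    by (rule finite_measure_UNION) (auto simp: disjoint_family_on_def)
  then have "prob (\<Union>k. {\<omega>\<in>space M. X \<omega> = real k}) = 1"
    using poisson_weights_sums[of r] unfolding p by (rule sums_unique2)
  from AE_prob_1[OF this] show ?thesis by auto
qed

text \<open>Conditioning on the value of \<open>X\<close>: on the event \<open>X = k\<close> the
  variable \<open>V\<close> is \<open>\<psi> k\<close> of \<open>Y\<close>, and independence factors
  the expectation. The growth bound is linear in \<open>k\<close> so that \<open>X\<close> times a
  bounded function is covered; Poisson weights have a finite first moment, which justifies
  exchanging sum and expectation.\<close>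

lemma poisson_expectation_sums:
  fixes \<psi> :: "nat \<Rightarrow> real \<Rightarrow> real"
  assumes X: "has_poisson_counts X r" and ind: "indep_var borel X borel Y"
    and meas: "\<And>k. \<psi> k \<in> borel_measurable borel"
    and bound: "\<And>k y. \<bar>\<psi> k y\<bar> \<le> C * real (Suc k)"
    and V: "random_variable borel V"
    and V_eq: "\<And>\<omega> k. \<omega> \<in> space M \<Longrightarrow> X \<omega> = real k \<Longrightarrow> V \<omega> = \<psi> k (Y \<omega>)"
  shows "integrable M V"
    and "(\<lambda>k. exp (- r) * r ^ k / fact k * expectation (\<lambda>\<omega>. \<psi> k (Y \<omega>))) sums expectation V"
proof -
  have [measurable]: "random_variable borel X" and r: "0 \<le> r" and
    p: "prob {\<omega>\<in>space M. X \<omega> = real k} = exp (- r) * r ^ k / fact k" for k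
    using X by (auto simp: has_poisson_counts_def)
  have [measurable]: "random_variable borel Y" using ind by (rule indep_var_rv2)
  note meas[measurable] V[measurable]
  have bound': "\<bar>\<psi> k y\<bar> \<le> \<bar>C\<bar> * real (Suc k)" for k y
    using bound[of k y] by (smt (verit) mult_right_mono of_nat_0_le_iff)
  define f where "f k \<omega> = indicator {real k} (X \<omega>) * \<psi> k (Y \<omega>)" for k \<omega>
  have int_ind: "integrable M (\<lambda>\<omega>. indicator {real k} (X \<omega>) :: real)" for k
    by (rule integrable_const_bound[where B=1]) (auto simp: indicator_def)
  have int_\<psi>: "integrable M (\<lambda>\<omega>. \<psi> k (Y \<omega>))" for k
    by (rule integrable_const_bound[where B="\<bar>C\<bar> * real (Suc k)"]) (use bound' in auto)
  have E_ind: "expectation (\<lambda>\<omega>. indicator {real k} (X \<omega>)) = exp (- r) * r ^ k / fact k" for k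
  proof -
    have "expectation (\<lambda>\<omega>. indicator {real k} (X \<omega>))
        = expectation (indicator {\<omega>\<in>space M. X \<omega> = real k})"
      by (intro Bochner_Integration.integral_cong) (auto simp: indicator_def)
    also have "\<dots> = prob {\<omega>\<in>space M. X \<omega> = real k}"
      by (subst Bochner_Integration.integral_indicator) (auto simp: Int_def intro!: arg_cong[where f=prob])
    finally show ?thesis by (simp add: p)
  qed
  have int_f: "integrable M (f k)" and E_f: "expectation (f k)
      = exp (- r) * r ^ k / fact k * expectation (\<lambda>\<omega>. \<psi> k (Y \<omega>))" for k
  proof -
    have ind': "indep_var borel (\<lambda>\<omega>. indicator {real k} (X \<omega>) :: real) borel (\<lambda>\<omega>. \<psi> k (Y \<omega>))"
      using indep_var_compose[OF ind, of "indicator {real k}" borel "\<psi> k" borel]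
      by (simp add: comp_def)
    show "integrable M (f k)"
      unfolding f_def[abs_def] by (rule indep_var_integrable[OF ind' int_ind int_\<psi>])
    show "expectation (f k) = exp (- r) * r ^ k / fact k * expectation (\<lambda>\<omega>. \<psi> k (Y \<omega>))"
      unfolding f_def[abs_def] indep_var_lebesgue_integral[OF ind' int_ind int_\<psi>] E_ind ..
  qed
  have single: "(\<lambda>k. f k \<omega>) sums V \<omega>" "summable (\<lambda>k. norm (f k \<omega>))"
    if "\<omega> \<in> space M" "X \<omega> = real n" for \<omega> n
  proof -
    have f0: "f k \<omega> = 0" if "k \<noteq> n" for k using that \<open>X \<omega> = real n\<close> by (simp add: f_def)
    have "f n \<omega> = V \<omega>" using V_eq[OF that] that by (simp add: f_def)
    then show "(\<lambda>k. f k \<omega>) sums V \<omega>"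
      using sums_finite[of "{n}" "\<lambda>k. f k \<omega>"] f0 by auto
    show "summable (\<lambda>k. norm (f k \<omega>))"
      by (rule summable_finite[of "{n}"]) (use f0 in auto)
  qed
  have AE_sum: "AE \<omega> in M. summable (\<lambda>k. norm (f k \<omega>))"
    using AE_has_poisson_counts[OF X] AE_space by eventually_elim (use single(2) in blast)
  have AE_V: "AE \<omega> in M. (\<Sum>k. f k \<omega>) = V \<omega>"
    using AE_has_poisson_counts[OF X] AE_space
    by eventually_elim (use single(1) sums_unique in metis)
  have sum: "summable (\<lambda>k. expectation (\<lambda>\<omega>. norm (f k \<omega>)))"
  proof (rule summable_comparison_test)
    have s1: "summable (\<lambda>k. r ^ k / fact k)"
      using summable_exp[of r] by (simp add: divide_inverse mult.commute)
    have "summable (\<lambda>k. real (Suc k) * (r ^ k / fact k))"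
    proof -
      have "summable (\<lambda>k. real (Suc k) * (r ^ Suc k / fact (Suc k)))"
      proof -
        have "real (Suc k) * (r ^ Suc k / fact (Suc k)) = r * (r ^ k / fact k)" for k
          by (simp add: fact_Suc del: of_nat_Suc)
        then show ?thesis using summable_mult[OF s1, of r] by simp
      qed
      then have "summable (\<lambda>k. real k * (r ^ k / fact k))"
        using summable_Suc_iff[of "\<lambda>k. real k * (r ^ k / fact k)"] by simp
      from summable_add[OF this s1] show ?thesis by (simp add: algebra_simps add_divide_distrib)
    qed
    then show "summable (\<lambda>k. \<bar>C\<bar> * exp (- r) * (real (Suc k) * (r ^ k / fact k)))"
      by (rule summable_mult)
    show "\<exists>N. \<forall>k\<ge>N. norm (expectation (\<lambda>\<omega>. norm (f k \<omega>)))
        \<le> \<bar>C\<bar> * exp (- r) * (real (Suc k) * (r ^ k / fact k))"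
    proof (intro exI allI impI)
      fix k :: nat
      have "expectation (\<lambda>\<omega>. norm (f k \<omega>))
          \<le> expectation (\<lambda>\<omega>. indicator {real k} (X \<omega>) * (\<bar>C\<bar> * real (Suc k)))"
        using bound'[of k]
        by (intro integral_mono integrable_norm int_f integrable_mult_left int_ind)
           (auto simp: f_def indicator_def)
      also have "\<dots> = exp (- r) * r ^ k / fact k * (\<bar>C\<bar> * real (Suc k))"
        unfolding integral_mult_left_zero E_ind ..
      finally show "norm (expectation (\<lambda>\<omega>. norm (f k \<omega>)))
          \<le> \<bar>C\<bar> * exp (- r) * (real (Suc k) * (r ^ k / fact k))"
        by (simp add: mult_ac)
    qed
  qed
  have "integrable M (\<lambda>\<omega>. \<Sum>k. f k \<omega>)"
    by (rule integrable_suminf[OF int_f AE_sum sum])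
  then show "integrable M V"
    by (rule integrable_cong_AE_imp) (use AE_V in \<open>auto elim: eventually_mono\<close>)
  have "(\<lambda>k. expectation (f k)) sums expectation (\<lambda>\<omega>. \<Sum>k. f k \<omega>)"
    by (rule sums_integral[OF int_f AE_sum sum])
  also have "expectation (\<lambda>\<omega>. \<Sum>k. f k \<omega>) = expectation V"
    by (rule integral_cong_AE) (use AE_V int_f in \<open>auto simp: borel_measurable_integrable\<close>)
  finally show "(\<lambda>k. exp (- r) * r ^ k / fact k * expectation (\<lambda>\<omega>. \<psi> k (Y \<omega>))) sums expectation V"
    unfolding E_f .
qed

text \<open>Mecke's formula for a single count: \<open>k\<close> times the weight of
  \<open>k\<close> is \<open>r\<close> times the weight of \<open>k - 1\<close>, so the factor
  \<open>X\<close> is traded for one additional point, visible as the shift by \<open>a\<close>. The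
  variable \<open>Y\<close> stands for the contribution of all other counts.\<close>

lemma poisson_stein_identity:
  fixes g :: "real \<Rightarrow> real"
  assumes X: "has_poisson_counts X r" and ind: "indep_var borel X borel Y"
    and g: "g \<in> borel_measurable borel" "\<And>x. \<bar>g x\<bar> \<le> C"
  shows "integrable M (\<lambda>\<omega>. X \<omega> * g (a * X \<omega> + Y \<omega>))"
    and "expectation (\<lambda>\<omega>. X \<omega> * g (a * X \<omega> + Y \<omega>))
      = r * expectation (\<lambda>\<omega>. g (a * X \<omega> + Y \<omega> + a))"
proof -
  have [measurable]: "random_variable borel X" using X by (simp add: has_poisson_counts_def)
  have [measurable]: "random_variable borel Y" using ind by (rule indep_var_rv2)
  note g(1)[measurable]
  have C: "0 \<le> C" using g(2)[of 0] by linarith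
  let ?p = "\<lambda>k. exp (- r) * r ^ k / fact k"
  define G where "G k = expectation (\<lambda>\<omega>. g (a * real k + Y \<omega>))" for k :: nat
  have bound1: "\<bar>real k * g (a * real k + y)\<bar> \<le> C * real (Suc k)" for k y
  proof -
    have "\<bar>real k * g (a * real k + y)\<bar> \<le> real k * C"
      unfolding abs_mult by (auto intro: mult_left_mono g)
    with C show ?thesis by (simp add: algebra_simps add_divide_distrib)
  qed
  note 1 = poisson_expectation_sums[OF X ind, of "\<lambda>k y. real k * g (a * real k + y)" C
      "\<lambda>\<omega>. X \<omega> * g (a * X \<omega> + Y \<omega>)", OF _ bound1]
  show "integrable M (\<lambda>\<omega>. X \<omega> * g (a * X \<omega> + Y \<omega>))"
    by (rule 1(1)) auto
  have s1: "(\<lambda>k. ?p k * (real k * G k)) sums expectation (\<lambda>\<omega>. X \<omega> * g (a * X \<omega> + Y \<omega>))"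
    using 1(2) by (simp add: G_def)
  have bound2: "\<bar>g (a * real k + y + a)\<bar> \<le> C * real (Suc k)" for k y
    using g(2)[of "a * real k + y + a"] C mult_left_mono[of 1 "real (Suc k)" C] by auto
  have s2: "(\<lambda>k. ?p k * G (Suc k)) sums expectation (\<lambda>\<omega>. g (a * X \<omega> + Y \<omega> + a))"
    using poisson_expectation_sums(2)[OF X ind, of "\<lambda>k y. g (a * real k + y + a)" C
      "\<lambda>\<omega>. g (a * X \<omega> + Y \<omega> + a)", OF _ bound2] by (simp add: G_def algebra_simps)
  have "?p (Suc k) * (real (Suc k) * G (Suc k)) = r * (?p k * G (Suc k))" for k
    by (simp add: fact_Suc del: of_nat_Suc)
  then have "(\<lambda>k. ?p (Suc k) * (real (Suc k) * G (Suc k))) sums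
      (r * expectation (\<lambda>\<omega>. g (a * X \<omega> + Y \<omega> + a)))"
    using sums_mult[OF s2, of r] by (simp only:)
  \<comment> \<open>Shift of the index by one; the term at \<open>k = 0\<close> is zero because of
    its factor \<open>k\<close>.\<close>
  then have "(\<lambda>k. ?p k * (real k * G k)) sums
      (r * expectation (\<lambda>\<omega>. g (a * X \<omega> + Y \<omega> + a)) + ?p 0 * (real 0 * G 0))"
    by (rule sums_Suc)
  with s1 show "expectation (\<lambda>\<omega>. X \<omega> * g (a * X \<omega> + Y \<omega>))
      = r * expectation (\<lambda>\<omega>. g (a * X \<omega> + Y \<omega> + a))"
    by (auto dest: sums_unique2)
qed

lemma poisson_sum_stein_identity:
  fixes g :: "real \<Rightarrow> real" and X :: "'i \<Rightarrow> 'a \<Rightarrow> real"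
  assumes I: "finite I" "i \<in> I" and ind: "indep_vars (\<lambda>_. borel) X I"
    and X: "has_poisson_counts (X i) r"
    and g: "g \<in> borel_measurable borel" "\<And>x. \<bar>g x\<bar> \<le> C"
  shows "integrable M (\<lambda>\<omega>. X i \<omega> * g (\<Sum>j\<in>I. a j * X j \<omega>))"
    and "expectation (\<lambda>\<omega>. X i \<omega> * g (\<Sum>j\<in>I. a j * X j \<omega>))
      = r * expectation (\<lambda>\<omega>. g ((\<Sum>j\<in>I. a j * X j \<omega>) + a i))"
proof -
  define J where "J = I - {i}"
  have J: "finite J" "i \<notin> J" "I = insert i J" using I by (auto simp: J_def)
  \<comment> \<open>The coefficient 1 at \<open>i\<close> puts \<open>X i\<close> itself into the
    independence statement; it could not be recovered from \<open>a i * X i\<close> when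
    \<open>a i = 0\<close>.\<close>
  define b where "b j = (if j = i then 1 else a j)" for j
  have "indep_vars (\<lambda>_. borel) (\<lambda>j \<omega>. b j * X j \<omega>) (insert i J)"
    by (rule indep_vars_compose2[of "\<lambda>_. borel"]) (use ind J in auto)
  from indep_vars_sum[OF J(1,2) this]
  have "indep_var borel (\<lambda>\<omega>. b i * X i \<omega>) borel (\<lambda>\<omega>. \<Sum>j\<in>J. b j * X j \<omega>)" .
  moreover have "(\<lambda>\<omega>. b i * X i \<omega>) = X i" by (simp add: b_def)
  moreover have "(\<Sum>j\<in>J. b j * X j \<omega>) = (\<Sum>j\<in>J. a j * X j \<omega>)" for \<omega>
    using J by (intro sum.cong) (auto simp: b_def)
  ultimately have ind': "indep_var borel (X i) borel (\<lambda>\<omega>. \<Sum>j\<in>J. a j * X j \<omega>)" by simp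
  have split: "(\<Sum>j\<in>I. a j * X j \<omega>) = a i * X i \<omega> + (\<Sum>j\<in>J. a j * X j \<omega>)" for \<omega>
    using J by simp
  show "integrable M (\<lambda>\<omega>. X i \<omega> * g (\<Sum>j\<in>I. a j * X j \<omega>))"
    unfolding split by (rule poisson_stein_identity(1)[OF X ind' g])
  show "expectation (\<lambda>\<omega>. X i \<omega> * g (\<Sum>j\<in>I. a j * X j \<omega>))
      = r * expectation (\<lambda>\<omega>. g ((\<Sum>j\<in>I. a j * X j \<omega>) + a i))"
    unfolding split by (rule poisson_stein_identity(2)[OF X ind' g])
qed

lemma taylor2_bound:
  fixes g g' g'' :: "real \<Rightarrow> real"
  assumes "\<And>x. (g has_real_derivative g' x) (at x)" "\<And>x. (g' has_real_derivative g'' x) (at x)"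
    and K: "\<And>x. \<bar>g'' x\<bar> \<le> K"
  shows "\<bar>g (w + a) - g w - a * g' w\<bar> \<le> K / 2 * a\<^sup>2"
proof (cases "a = 0")
  case False
  define d where "d m = (if m = 0 then g else if m = 1 then g' else g'')" for m :: nat
  have "\<exists>t. (if w + a < w then w + a < t \<and> t < w else w < t \<and> t < w + a) \<and>
      g (w + a) = (\<Sum>m<2. (d m w / fact m) * (w + a - w) ^ m) + (d 2 t / fact 2) * (w + a - w) ^ 2"
    by (rule Taylor[where a="min w (w + a)" and b="max w (w + a)"])
       (use False assms in \<open>auto simp: d_def less_2_cases_iff\<close>)
  then obtain t where "g (w + a)
      = (\<Sum>m<2. (d m w / fact m) * (w + a - w) ^ m) + (d 2 t / fact 2) * (w + a - w) ^ 2"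
    by blast
  then have "g (w + a) - g w - a * g' w = g'' t / 2 * a\<^sup>2"
    by (simp add: d_def lessThan_nat_numeral)
  moreover have "\<bar>g'' t / 2 * a\<^sup>2\<bar> \<le> K / 2 * a\<^sup>2"
    using K[of t] by (auto simp: abs_mult intro!: mult_right_mono)
  ultimately show ?thesis by (simp only:)
qed simp

text \<open>Stein's equation turns the left side into \<open>E (g' T) - E (T * g T)\<close>, and the
  Poisson identity rewrites the last expectation as the sum of
  \<open>a i * r i * E (g (T + a i))\<close>. Expanding in \<open>a i\<close>, the constant term
  meets the mean of \<open>T\<close>, the linear term its variance, and the remainder the third
  moment. The factors 8, 3 and 6 are the bounds on \<open>g'\<close>, on \<open>g\<close> and on
  half of \<open>g''\<close>.\<close>

lemma poisson_sum_normal_bound_smooth: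
  fixes X :: "'i \<Rightarrow> 'a \<Rightarrow> real" and a r :: "'i \<Rightarrow> real" and h h' :: "real \<Rightarrow> real"
  assumes I: "finite I" and ind: "indep_vars (\<lambda>_. borel) X I"
    and X: "\<And>i. i \<in> I \<Longrightarrow> has_poisson_counts (X i) (r i)"
    and h: "\<And>x. (h has_real_derivative h' x) (at x)" "\<And>x. \<bar>h' x\<bar> \<le> 1"
  defines "T \<equiv> \<lambda>\<omega>. \<Sum>i\<in>I. a i * X i \<omega>"
  shows "\<bar>expectation (\<lambda>\<omega>. h (T \<omega>)) - (\<integral>z. std_normal_density z * h z \<partial>lborel)\<bar>
    \<le> 8 * \<bar>1 - (\<Sum>i\<in>I. (a i)\<^sup>2 * r i)\<bar> + 3 * \<bar>\<Sum>i\<in>I. a i * r i\<bar> + 6 * (\<Sum>i\<in>I. \<bar>a i\<bar> ^ 3 * r i)"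
proof -
  define m where "m = (\<integral>z. std_normal_density z * h z \<partial>lborel)"
  obtain g g' g'' where Dg: "\<And>x. (g has_real_derivative g' x) (at x)"
    and Dg': "\<And>x. (g' has_real_derivative g'' x) (at x)"
    and stein: "\<And>x. g' x - x * g x = h x - m"
    and g3: "\<And>x. \<bar>g x\<bar> \<le> 3" and g8: "\<And>x. \<bar>g' x\<bar> \<le> 8" and g12: "\<And>x. \<bar>g'' x\<bar> \<le> 12"
    by (rule stein_solution[OF h, folded m_def]) (rule that; assumption)
  have meas_g [measurable]: "g \<in> borel_measurable borel"
    by (intro borel_measurable_continuous_onI DERIV_continuous_on[of _ g g'])
       (use Dg in \<open>auto intro: has_field_derivative_at_within\<close>)
  have meas_g' [measurable]: "g' \<in> borel_measurable borel"
    by (intro borel_measurable_continuous_onI DERIV_continuous_on[of _ g' g''])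
       (use Dg' in \<open>auto intro: has_field_derivative_at_within\<close>)
  have rv [measurable]: "random_variable borel (X i)" and r: "0 \<le> r i" if "i \<in> I" for i
    using X[OF that] by (auto simp: has_poisson_counts_def)
  have T [measurable]: "random_variable borel T"
    unfolding T_def by (intro borel_measurable_sum borel_measurable_times rv) auto
  have int_g: "integrable M (\<lambda>\<omega>. g (T \<omega> + c))" for c
    by (rule integrable_const_bound[where B=3]) (use g3 in auto)
  have int_g': "integrable M (\<lambda>\<omega>. g' (T \<omega>))"
    by (rule integrable_const_bound[where B=8]) (use g8 in auto)
  have id: "integrable M (\<lambda>\<omega>. X i \<omega> * g (T \<omega>))"
    "expectation (\<lambda>\<omega>. X i \<omega> * g (T \<omega>)) = r i * expectation (\<lambda>\<omega>. g (T \<omega> + a i))" if "i \<in> I" for i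
    unfolding T_def by (rule poisson_sum_stein_identity[OF I that ind X[OF that] meas_g g3])+
  have Tg: "T \<omega> * g (T \<omega>) = (\<Sum>i\<in>I. a i * (X i \<omega> * g (T \<omega>)))" for \<omega>
    by (simp add: T_def sum_distrib_right mult.assoc)
  have int_Tg: "integrable M (\<lambda>\<omega>. T \<omega> * g (T \<omega>))"
    unfolding Tg by (intro Bochner_Integration.integrable_sum integrable_mult_right id)
  have E_Tg: "expectation (\<lambda>\<omega>. T \<omega> * g (T \<omega>))
      = (\<Sum>i\<in>I. a i * r i * expectation (\<lambda>\<omega>. g (T \<omega> + a i)))"
  proof -
    have "expectation (\<lambda>\<omega>. T \<omega> * g (T \<omega>)) = (\<Sum>i\<in>I. expectation (\<lambda>\<omega>. a i * (X i \<omega> * g (T \<omega>))))"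
      unfolding Tg by (intro Bochner_Integration.integral_sum integrable_mult_right id)
    also have "\<dots> = (\<Sum>i\<in>I. a i * r i * expectation (\<lambda>\<omega>. g (T \<omega> + a i)))"
    proof (rule sum.cong[OF refl])
      fix i assume "i \<in> I"
      then show "expectation (\<lambda>\<omega>. a i * (X i \<omega> * g (T \<omega>)))
          = a i * r i * expectation (\<lambda>\<omega>. g (T \<omega> + a i))"
        by (simp add: id(2) mult.assoc)
    qed
    finally show ?thesis .
  qed
  have step: "\<bar>expectation (\<lambda>\<omega>. g (T \<omega> + c)) - expectation (\<lambda>\<omega>. g (T \<omega>))
      - c * expectation (\<lambda>\<omega>. g' (T \<omega>))\<bar> \<le> 6 * c\<^sup>2" for c
  proof -
    have "expectation (\<lambda>\<omega>. g (T \<omega> + c)) - expectation (\<lambda>\<omega>. g (T \<omega>)) - c * expectation (\<lambda>\<omega>. g' (T \<omega>))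
        = expectation (\<lambda>\<omega>. g (T \<omega> + c) - g (T \<omega>) - c * g' (T \<omega>))"
      using int_g[of c] int_g[of 0] int_g' by simp
    also have "\<bar>\<dots>\<bar> \<le> 6 * c\<^sup>2"
    proof (rule abs_expectation_le)
      show "integrable M (\<lambda>\<omega>. g (T \<omega> + c) - g (T \<omega>) - c * g' (T \<omega>))"
        using int_g[of c] int_g[of 0] int_g' by simp
      show "\<bar>g (T \<omega> + c) - g (T \<omega>) - c * g' (T \<omega>)\<bar> \<le> 6 * c\<^sup>2" for \<omega>
        using taylor2_bound[OF Dg Dg' g12, of "T \<omega>" c] by simp
    qed
    finally show ?thesis .
  qed
  define A where "A = expectation (\<lambda>\<omega>. g (T \<omega>))"
  define B where "B = expectation (\<lambda>\<omega>. g' (T \<omega>))"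
  have A3: "\<bar>A\<bar> \<le> 3"
    unfolding A_def using int_g[of 0] g3 by (intro abs_expectation_le) auto
  have B8: "\<bar>B\<bar> \<le> 8"
    unfolding B_def using int_g' g8 by (intro abs_expectation_le) auto
  define s where "s = (\<Sum>i\<in>I. (a i)\<^sup>2 * r i)"
  \<comment> \<open>What is left of the shift by \<open>a i\<close> after its linear term; by
    \<open>step\<close> it is at most \<open>6 * (a i)^2\<close>.\<close>
  define e where "e i = expectation (\<lambda>\<omega>. g (T \<omega> + a i)) - A - a i * B" for i
  have "(\<Sum>i\<in>I. a i * r i * expectation (\<lambda>\<omega>. g (T \<omega> + a i)))
      = (\<Sum>i\<in>I. a i * r i) * A + s * B + (\<Sum>i\<in>I. a i * r i * e i)"
  proof -
    have "a i * r i * expectation (\<lambda>\<omega>. g (T \<omega> + a i))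
        = a i * r i * A + (a i)\<^sup>2 * r i * B + a i * r i * e i" for i
      by (simp add: e_def algebra_simps power2_eq_square)
    then show ?thesis by (simp add: s_def sum_distrib_right sum.distrib)
  qed
  moreover have "\<bar>\<Sum>i\<in>I. a i * r i * e i\<bar> \<le> (\<Sum>i\<in>I. 6 * (\<bar>a i\<bar> ^ 3 * r i))"
  proof (rule order_trans[OF sum_abs], rule sum_mono)
    fix i assume i: "i \<in> I"
    have "\<bar>a i * r i * e i\<bar> \<le> \<bar>a i\<bar> * r i * (6 * (a i)\<^sup>2)"
      unfolding abs_mult using step[of "a i"] r[OF i]
      by (auto simp: e_def A_def B_def intro!: mult_left_mono)
    also have "\<dots> = 6 * (\<bar>a i\<bar> ^ 3 * r i)"
    proof -
      have "\<bar>a i\<bar> ^ 3 = \<bar>a i\<bar> * (a i)\<^sup>2" by (simp add: power3_eq_cube power2_eq_square)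
      then show ?thesis by simp
    qed
    finally show "\<bar>a i * r i * e i\<bar> \<le> 6 * (\<bar>a i\<bar> ^ 3 * r i)" .
  qed
  moreover have "expectation (\<lambda>\<omega>. h (T \<omega>)) - m = B - expectation (\<lambda>\<omega>. T \<omega> * g (T \<omega>))"
  proof -
    have "h x = m + (g' x - x * g x)" for x using stein[of x] by simp
    then have "expectation (\<lambda>\<omega>. h (T \<omega>)) = expectation (\<lambda>\<omega>. m + (g' (T \<omega>) - T \<omega> * g (T \<omega>)))"
      by simp
    also have "\<dots> = m + (B - expectation (\<lambda>\<omega>. T \<omega> * g (T \<omega>)))"
      using int_g' int_Tg by (simp add: B_def prob_space)
    finally show ?thesis by simp
  qed
  ultimately have "\<bar>expectation (\<lambda>\<omega>. h (T \<omega>)) - m\<bar>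
      \<le> \<bar>(1 - s) * B\<bar> + \<bar>(\<Sum>i\<in>I. a i * r i) * A\<bar> + 6 * (\<Sum>i\<in>I. \<bar>a i\<bar> ^ 3 * r i)"
    unfolding E_Tg by (simp add: sum_distrib_left left_diff_distrib)
  moreover have "\<bar>(1 - s) * B\<bar> \<le> \<bar>1 - s\<bar> * 8"
    unfolding abs_mult by (intro mult_left_mono B8) simp
  moreover have "\<bar>(\<Sum>i\<in>I. a i * r i) * A\<bar> \<le> \<bar>\<Sum>i\<in>I. a i * r i\<bar> * 3"
    unfolding abs_mult by (intro mult_left_mono A3) simp
  ultimately show ?thesis unfolding s_def m_def by linarith
qed

end

section \<open>Integrals against a Poisson random measure\<close>

text \<open>The range of \<open>f\<close> is cut into half-open bands of width \<open>e\<close>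
  starting at \<open>- B\<close>, and \<open>c i\<close> is the lower edge of band
  \<open>i\<close>.\<close>

lemma ex_level_set_partition:
  fixes f :: "'b \<Rightarrow> real"
  assumes f: "f \<in> borel_measurable L" and B: "\<And>\<xi>. \<xi> \<in> space L \<Longrightarrow> \<bar>f \<xi>\<bar> \<le> B" and e: "0 < e"
  obtains n :: nat and A c where "\<And>i. A i \<in> sets L" "disjoint_family A"
    "space L = (\<Union>i<n. A i)" "\<And>i \<xi>. \<xi> \<in> A i \<Longrightarrow> \<bar>f \<xi> - c i\<bar> \<le> e"
proof -
  define c where "c i = real i * e - B" for i :: nat
  define A where "A i = {\<xi> \<in> space L. c i \<le> f \<xi> \<and> f \<xi> < c (Suc i)}" for i
  have c_mono: "c i \<le> c j" if "i \<le> j" for i j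
    using that e by (simp add: c_def)
  show ?thesis
  \<comment> \<open>Values up to \<open>B\<close> fall into bands with index at most the floor of
    \<open>2 * B / e\<close>; the added 1 includes that last band.\<close>
  proof (rule that[of A "nat \<lfloor>2 * B / e\<rfloor> + 1" c])
    show "A i \<in> sets L" for i unfolding A_def using f by measurable
    have "i = j" if "\<xi> \<in> A i" "\<xi> \<in> A j" for i j \<xi>
      using that c_mono[of "Suc i" j] c_mono[of "Suc j" i] by (force simp: A_def not_le)
    then show "disjoint_family A" by (auto simp: disjoint_family_on_def)
    show "\<bar>f \<xi> - c i\<bar> \<le> e" if "\<xi> \<in> A i" for i \<xi>
      using that by (auto simp: A_def c_def algebra_simps)
    have "\<exists>i < nat \<lfloor>2 * B / e\<rfloor> + 1. \<xi> \<in> A i" if "\<xi> \<in> space L" for \<xi>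
    proof (intro exI conjI)
      let ?y = "(f \<xi> + B) / e"
      have y: "0 \<le> ?y" "?y \<le> 2 * B / e" using B[OF that] e by (auto simp: divide_right_mono)
      then have "nat \<lfloor>?y\<rfloor> \<le> nat \<lfloor>2 * B / e\<rfloor>" by (intro nat_mono floor_mono)
      then show "nat \<lfloor>?y\<rfloor> < nat \<lfloor>2 * B / e\<rfloor> + 1" by simp
      have "real (nat \<lfloor>?y\<rfloor>) \<le> ?y" "?y < real (nat \<lfloor>?y\<rfloor>) + 1" using y(1) by linarith+
      then have "real (nat \<lfloor>?y\<rfloor>) * e \<le> f \<xi> + B" "f \<xi> + B < (real (nat \<lfloor>?y\<rfloor>) + 1) * e"
        using e by (auto simp: pos_le_divide_eq pos_divide_less_eq)
      then show "\<xi> \<in> A (nat \<lfloor>?y\<rfloor>)" using that by (simp add: A_def c_def algebra_simps)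
    qed
    then show "space L = (\<Union>i<nat \<lfloor>2 * B / e\<rfloor> + 1. A i)" by (auto simp: A_def)
  qed
qed

text \<open>On each cell the integrand differs from its weight by at most \<open>d\<close>. The
  lemma serves two kinds of measure: a realisation \<open>N \<omega>\<close>, where it compares the
  integral with a sum of counts, and the intensity, where it compares the moments of
  \<open>f\<close> with those of the sum.\<close>

lemma partition_sum_integral_bound:
  fixes f :: "'b \<Rightarrow> real" and w :: "nat \<Rightarrow> real"
  assumes "finite_measure L" and A: "\<And>i. A i \<in> sets L" "disjoint_family A"
    "space L = (\<Union>i<n. A i)" and f: "integrable L f"
    and d: "\<And>i \<xi>. i < n \<Longrightarrow> \<xi> \<in> A i \<Longrightarrow> \<bar>f \<xi> - w i\<bar> \<le> d"
  shows "\<bar>(\<integral>\<xi>. f \<xi> \<partial>L) - (\<Sum>i<n. w i * measure L (A i))\<bar> \<le> d * measure L (space L)"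
proof -
  interpret finite_measure L by fact
  have int: "integrable L (\<lambda>\<xi>. w i * indicator (A i) \<xi>)" for i
    using A(1) by (intro integrable_mult_right integrable_real_indicator) (auto simp: less_top[symmetric])
  then have int_sum: "integrable L (\<lambda>\<xi>. \<Sum>i<n. w i * indicator (A i) \<xi>)"
    by (intro Bochner_Integration.integrable_sum)
  have "(\<integral>\<xi>. (\<Sum>i<n. w i * indicator (A i) \<xi>) \<partial>L) = (\<Sum>i<n. w i * measure L (A i))"
    using A(1) sets.sets_into_space[OF A(1)]
    by (subst Bochner_Integration.integral_sum[OF int]) (auto simp: Int_absorb2 intro!: sum.cong)
  then have eq: "(\<integral>\<xi>. f \<xi> \<partial>L) - (\<Sum>i<n. w i * measure L (A i))
      = (\<integral>\<xi>. f \<xi> - (\<Sum>i<n. w i * indicator (A i) \<xi>) \<partial>L)"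
    using Bochner_Integration.integral_diff[OF f int_sum] by simp
  have "\<bar>\<integral>\<xi>. f \<xi> - (\<Sum>i<n. w i * indicator (A i) \<xi>) \<partial>L\<bar> \<le> (\<integral>\<xi>. d \<partial>L)"
  proof (rule integral_abs_le_integral)
    show "integrable L (\<lambda>\<xi>. f \<xi> - (\<Sum>i<n. w i * indicator (A i) \<xi>))"
      using f int_sum by (rule Bochner_Integration.integrable_diff)
    fix \<xi> assume "\<xi> \<in> space L"
    then obtain i where i: "i < n" "\<xi> \<in> A i" using A(3) by auto
    have "(\<Sum>j<n. w j * indicator (A j) \<xi>) = (\<Sum>j<n. if j = i then w j else 0)"
    proof (rule sum.cong[OF refl])
      fix j
      have "\<xi> \<notin> A j" if "j \<noteq> i" using A(2) i(2) that by (auto simp: disjoint_family_on_def)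
      then show "w j * indicator (A j) \<xi> = (if j = i then w j else 0)" using i(2) by auto
    qed
    also have "\<dots> = w i" using i(1) by simp
    finally show "\<bar>f \<xi> - (\<Sum>j<n. w j * indicator (A j) \<xi>)\<bar> \<le> d" using d[OF i] by simp
  qed simp
  then show ?thesis unfolding eq by (simp add: mult.commute)
qed

section \<open>Measurability, laws and means of the counts\<close>

context
  fixes M :: "'a measure" and N :: "'a \<Rightarrow> 'b measure" and L :: "'b measure"
  assumes prm: "poisson_random_measure M N L"
begin

interpretation prob_space M
  using prm by (simp add: poisson_random_measure_def)

lemma sets_prm: "\<omega> \<in> space M \<Longrightarrow> sets (N \<omega>) = sets L"
  using prm by (simp add: poisson_random_measure_def)

lemma measurable_prm: "A \<in> sets L \<Longrightarrow> (\<lambda>\<omega>. emeasure (N \<omega>) A) \<in> borel_measurable M"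
  using prm by (simp add: poisson_random_measure_def)

lemma borel_measurable_prm: "f \<in> borel_measurable L \<Longrightarrow> \<omega> \<in> space M \<Longrightarrow> f \<in> borel_measurable (N \<omega>)"
  using measurable_cong_sets[OF sets_prm refl] by blast

text \<open>Measurability in \<open>\<omega>\<close> is known for counts of sets only; induction
  over nonnegative measurable functions carries it to integrals.\<close>

lemma measurable_nn_integral_prm:
  assumes "u \<in> borel_measurable L"
  shows "(\<lambda>\<omega>. \<integral>\<^sup>+\<xi>. u \<xi> \<partial>N \<omega>) \<in> borel_measurable M"
  using assms
proof (induction rule: borel_measurable_induct)
  case (cong f g)
  have "(\<integral>\<^sup>+\<xi>. f \<xi> \<partial>N \<omega>) = (\<integral>\<^sup>+\<xi>. g \<xi> \<partial>N \<omega>)" if "\<omega> \<in> space M" for \<omega>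
    using sets_eq_imp_space_eq[OF sets_prm[OF that]] cong(3) by (intro nn_integral_cong) auto
  with cong(4) show ?case by (simp cong: measurable_cong)
next
  case (set A)
  have "(\<integral>\<^sup>+\<xi>. indicator A \<xi> \<partial>N \<omega>) = emeasure (N \<omega>) A" if "\<omega> \<in> space M" for \<omega>
    using sets_prm[OF that] set by (intro nn_integral_indicator) auto
  with measurable_prm[OF set] show ?case by (simp cong: measurable_cong)
next
  case (mult u c)
  have "(\<integral>\<^sup>+\<xi>. c * u \<xi> \<partial>N \<omega>) = c * (\<integral>\<^sup>+\<xi>. u \<xi> \<partial>N \<omega>)" if "\<omega> \<in> space M" for \<omega>
    by (intro nn_integral_cmult borel_measurable_prm[OF mult(2)] that)
  moreover have "(\<lambda>\<omega>. c * (\<integral>\<^sup>+\<xi>. u \<xi> \<partial>N \<omega>)) \<in> borel_measurable M"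
    by (intro borel_measurable_times_ennreal borel_measurable_const mult.IH)
  ultimately show ?case by (simp cong: measurable_cong)
next
  case (add u v)
  have "(\<integral>\<^sup>+\<xi>. v \<xi> + u \<xi> \<partial>N \<omega>) = (\<integral>\<^sup>+\<xi>. v \<xi> \<partial>N \<omega>) + (\<integral>\<^sup>+\<xi>. u \<xi> \<partial>N \<omega>)"
    if "\<omega> \<in> space M" for \<omega>
    by (intro nn_integral_add borel_measurable_prm[OF add(1)] borel_measurable_prm[OF add(3)] that)
  moreover have "(\<lambda>\<omega>. (\<integral>\<^sup>+\<xi>. v \<xi> \<partial>N \<omega>) + (\<integral>\<^sup>+\<xi>. u \<xi> \<partial>N \<omega>)) \<in> borel_measurable M"
    by (intro borel_measurable_add add.IH)
  ultimately show ?case by (simp cong: measurable_cong)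
next
  case (seq U)
  have "(\<integral>\<^sup>+\<xi>. (SUP i. U i) \<xi> \<partial>N \<omega>) = (SUP i. \<integral>\<^sup>+\<xi>. U i \<xi> \<partial>N \<omega>)" if "\<omega> \<in> space M" for \<omega>
    unfolding SUP_apply
    by (intro nn_integral_monotone_convergence_SUP borel_measurable_prm[OF seq(1)] that seq)
  moreover have "(\<lambda>\<omega>. SUP i. \<integral>\<^sup>+\<xi>. U i \<xi> \<partial>N \<omega>) \<in> borel_measurable M"
    by (intro borel_measurable_SUP seq.IH) auto
  ultimately show ?case by (simp cong: measurable_cong)
qed

lemma measurable_integral_prm:
  fixes f :: "'b \<Rightarrow> real"
  assumes f [measurable]: "f \<in> borel_measurable L"
  shows "(\<lambda>\<omega>. \<integral>\<xi>. f \<xi> \<partial>N \<omega>) \<in> borel_measurable M"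
proof -
  let ?I = "\<lambda>u \<omega>. \<integral>\<^sup>+\<xi>. ennreal (u \<xi>) \<partial>N \<omega>"
  \<comment> \<open>The Bochner integral of a non-integrable function is 0. The case distinction
    makes the formula hold for every \<open>\<omega>\<close>, including those where
    \<open>N \<omega>\<close> has infinite mass.\<close>
  have eq: "(\<integral>\<xi>. f \<xi> \<partial>N \<omega>) = (if ?I (\<lambda>\<xi>. \<bar>f \<xi>\<bar>) \<omega> < \<infinity>
      then enn2real (?I f \<omega>) - enn2real (?I (\<lambda>\<xi>. - f \<xi>) \<omega>) else 0)" if "\<omega> \<in> space M" for \<omega>
  proof -
    have [measurable]: "f \<in> borel_measurable (N \<omega>)"
      by (rule borel_measurable_prm[OF f that])
    have "integrable (N \<omega>) f \<longleftrightarrow> ?I (\<lambda>\<xi>. \<bar>f \<xi>\<bar>) \<omega> < \<infinity>"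
      by (simp add: integrable_iff_bounded)
    then show ?thesis
      by (auto simp: real_lebesgue_integral_def not_integrable_integral_eq)
  qed
  have [measurable]: "?I u \<in> borel_measurable M" if "u \<in> borel_measurable L" for u
    using that by (intro measurable_nn_integral_prm) measurable
  show ?thesis
    by (subst measurable_cong[OF eq]) measurable
qed

text \<open>The Poisson weights add up to 1, so an infinite count has probability zero. The passage
  to real counts depends on this: \<open>measure\<close> reads an infinite count as 0 and would
  otherwise enlarge the event of no points.\<close>

lemma prm_counts:
  assumes A: "A \<in> sets L" "emeasure L A < \<infinity>"
  shows "has_poisson_counts (\<lambda>\<omega>. measure (N \<omega>) A) (measure L A)"
    and "AE \<omega> in M. emeasure (N \<omega>) A < \<infinity>"
proof -
  note [measurable] = measurable_prm[OF A(1)]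
  have p: "prob {\<omega>\<in>space M. emeasure (N \<omega>) A = of_nat k}
      = exp (- measure L A) * measure L A ^ k / fact k" for k
    using prm A unfolding poisson_random_measure_def by blast
  have "(\<lambda>k. prob {\<omega>\<in>space M. emeasure (N \<omega>) A = of_nat k})
      sums prob (\<Union>k. {\<omega>\<in>space M. emeasure (N \<omega>) A = of_nat k})"
    by (rule finite_measure_UNION) (auto simp: disjoint_family_on_def)
  then have "prob (\<Union>k. {\<omega>\<in>space M. emeasure (N \<omega>) A = of_nat k}) = 1"
    using poisson_weights_sums[of "measure L A"] unfolding p by (rule sums_unique2)
  from AE_prob_1[OF this] have AE: "AE \<omega> in M. \<exists>k::nat. emeasure (N \<omega>) A = of_nat k" by auto
  then show "AE \<omega> in M. emeasure (N \<omega>) A < \<infinity>"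
    by eventually_elim (metis infinity_ennreal_def of_nat_less_top)
  show "has_poisson_counts (\<lambda>\<omega>. measure (N \<omega>) A) (measure L A)"
    unfolding has_poisson_counts_def
  proof (intro conjI allI)
    show "random_variable borel (\<lambda>\<omega>. measure (N \<omega>) A)" unfolding measure_def by measurable
    fix k :: nat
    have "prob {\<omega>\<in>space M. measure (N \<omega>) A = real k} = prob {\<omega>\<in>space M. emeasure (N \<omega>) A = of_nat k}"
    proof (rule measure_eq_AE)
      show "AE \<omega> in M. \<omega> \<in> {\<omega>\<in>space M. measure (N \<omega>) A = real k}
          \<longleftrightarrow> \<omega> \<in> {\<omega>\<in>space M. emeasure (N \<omega>) A = of_nat k}"
        using AE by eventually_elim (auto simp: measure_def)
    qed (unfold measure_def, measurable)
    then show "prob {\<omega>\<in>space M. measure (N \<omega>) A = real k}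
        = exp (- measure L A) * measure L A ^ k / fact k"
      using p by simp
  qed simp
qed

lemma prm_indep_counts:
  assumes A: "\<And>i. A i \<in> sets L" "disjoint_family A"
  shows "indep_vars (\<lambda>_. borel) (\<lambda>i \<omega>. measure (N \<omega>) (A i)) {..<n::nat}"
proof -
  have "disjoint_family_on A {..<n}" using A(2) by (auto simp: disjoint_family_on_def)
  then have "indep_vars (\<lambda>_. borel) (\<lambda>i \<omega>. emeasure (N \<omega>) (A i)) {..<n}"
    using prm A(1) unfolding poisson_random_measure_def by blast
  then show ?thesis
    unfolding measure_def by (rule indep_vars_compose2) measurable
qed

text \<open>The Poisson identity with the constant function 1 says that the mean of a count is its
  parameter. Independence is stated for finite families, so \<open>A\<close> is made the only member
  of a family indexed by \<open>{..<1}\<close> and padded with empty sets.\<close>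

lemma prm_counts_mean:
  assumes A: "A \<in> sets L" "emeasure L A < \<infinity>"
  shows "integrable M (\<lambda>\<omega>. measure (N \<omega>) A)"
    and "expectation (\<lambda>\<omega>. measure (N \<omega>) A) = measure L A"
proof -
  define A' where "A' i = (if i = 0 then A else {})" for i :: nat
  have "indep_vars (\<lambda>_. borel) (\<lambda>i \<omega>. measure (N \<omega>) (A' i)) {..<1::nat}"
    using A by (intro prm_indep_counts) (auto simp: A'_def disjoint_family_on_def)
  note * = poisson_sum_stein_identity[OF _ _ this, of 0 "measure L A" "\<lambda>_. 1" 1 "\<lambda>_. 0"]
  show "integrable M (\<lambda>\<omega>. measure (N \<omega>) A)"
    using *(1) prm_counts(1)[OF A] by (simp add: A'_def)
  show "expectation (\<lambda>\<omega>. measure (N \<omega>) A) = measure L A"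
    using *(2) prm_counts(1)[OF A] by (simp add: A'_def prob_space)
qed

section \<open>Normal approximation of an integral against the Poisson measure\<close>

lemma integrable_lipschitz_comp:
  fixes h :: "real \<Rightarrow> real"
  assumes h: "1-lipschitz_on UNIV h" and T: "integrable M T"
  shows "integrable M (\<lambda>\<omega>. h (T \<omega>))"
proof (rule Bochner_Integration.integrable_bound)
  show "integrable M (\<lambda>\<omega>. \<bar>h 0\<bar> + \<bar>T \<omega>\<bar>)" using T by auto
  have "h \<in> borel_measurable borel"
    using lipschitz_on_continuous_on[OF h] by (rule borel_measurable_continuous_onI)
  then show "(\<lambda>\<omega>. h (T \<omega>)) \<in> borel_measurable M"
    using borel_measurable_integrable[OF T] by (rule measurable_compose[rotated])
  have "\<bar>h x\<bar> \<le> \<bar>h 0\<bar> + \<bar>x\<bar>" for x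
    using lipschitz_onD[OF h, of x 0] by (simp add: dist_real_def)
  then show "AE \<omega> in M. norm (h (T \<omega>)) \<le> norm (\<bar>h 0\<bar> + \<bar>T \<omega>\<bar>)" by simp
qed

text \<open>The bound \<open>Y\<close> is random because the discretisation error is
  \<open>e\<close> times the number of points, which is integrable but unbounded.\<close>

lemma expectation_lipschitz_diff:
  fixes h :: "real \<Rightarrow> real"
  assumes h: "1-lipschitz_on UNIV h" and T: "integrable M T" "integrable M S" and Y: "integrable M Y"
    and TS: "AE \<omega> in M. \<bar>T \<omega> - S \<omega>\<bar> \<le> Y \<omega>"
  shows "\<bar>expectation (\<lambda>\<omega>. h (T \<omega>)) - expectation (\<lambda>\<omega>. h (S \<omega>))\<bar> \<le> expectation Y"
proof -
  note int = integrable_lipschitz_comp[OF h T(1)] integrable_lipschitz_comp[OF h T(2)]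
  have "\<bar>expectation (\<lambda>\<omega>. h (T \<omega>)) - expectation (\<lambda>\<omega>. h (S \<omega>))\<bar>
      = \<bar>expectation (\<lambda>\<omega>. h (T \<omega>) - h (S \<omega>))\<bar>"
    using int by simp
  also have "\<dots> \<le> expectation (\<lambda>\<omega>. \<bar>h (T \<omega>) - h (S \<omega>)\<bar>)" by (rule integral_abs_bound)
  also have "\<dots> \<le> expectation Y"
  proof (rule integral_mono_AE)
    have "\<bar>h x - h y\<bar> \<le> \<bar>x - y\<bar>" for x y
      using lipschitz_onD[OF h, of x y] by (simp add: dist_real_def)
    then show "AE \<omega> in M. \<bar>h (T \<omega>) - h (S \<omega>)\<bar> \<le> Y \<omega>"
      using TS by (auto elim!: eventually_mono intro: order_trans)
  qed (use int Y in auto)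
  finally show ?thesis .
qed

text \<open>With level sets of width \<open>e\<close>, the integral \<open>T\<close> is within
  \<open>e\<close> times the number of points of \<open>S\<close>, a sum of independent scaled
  counts. The bound for such sums applies to \<open>S\<close>, its three moment terms are within a
  multiple of \<open>e\<close> of their values for \<open>f\<close>, and \<open>e\<close> tends to
  0.\<close>

lemma prm_integral_normal_bound_smooth:
  fixes f :: "'b \<Rightarrow> real" and h h' :: "real \<Rightarrow> real"
  assumes L: "finite_measure L" and f: "f \<in> borel_measurable L"
    and B: "\<And>\<xi>. \<xi> \<in> space L \<Longrightarrow> \<bar>f \<xi>\<bar> \<le> B"
    and f1: "(\<integral>\<xi>. f \<xi> \<partial>L) = 0" and f2: "(\<integral>\<xi>. (f \<xi>)\<^sup>2 \<partial>L) = 1"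
    and h: "\<And>x. (h has_real_derivative h' x) (at x)" "\<And>x. \<bar>h' x\<bar> \<le> 1"
    and lip: "1-lipschitz_on UNIV h"
  shows "integrable M (\<lambda>\<omega>. \<integral>\<xi>. f \<xi> \<partial>N \<omega>)"
    and "\<bar>expectation (\<lambda>\<omega>. h (\<integral>\<xi>. f \<xi> \<partial>N \<omega>)) - (\<integral>z. std_normal_density z * h z \<partial>lborel)\<bar>
      \<le> 6 * (\<integral>\<xi>. \<bar>f \<xi>\<bar> ^ 3 \<partial>L)"
proof -
  interpret L: finite_measure L by fact
  note [measurable] = f
  define T where "T \<omega> = (\<integral>\<xi>. f \<xi> \<partial>N \<omega>)" for \<omega>
  define m where "m = (\<integral>z. std_normal_density z * h z \<partial>lborel)"
  define l where "l = measure L (space L)"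
  have finL: "emeasure L A < \<infinity>" for A by (simp add: less_top[symmetric])
  note tot = prm_counts_mean[OF sets.top finL]
  have fin: "AE \<omega> in M. finite_measure (N \<omega>)"
    using prm_counts(2)[OF sets.top finL] AE_space
  proof eventually_elim
    case (elim \<omega>)
    then show ?case using sets_eq_imp_space_eq[OF sets_prm[of \<omega>]] by (intro finite_measureI) auto
  qed
  have int_f: "integrable (N \<omega>) f" if "\<omega> \<in> space M" "finite_measure (N \<omega>)" for \<omega>
    using borel_measurable_prm[OF f that(1)] B sets_eq_imp_space_eq[OF sets_prm[OF that(1)]]
    by (intro finite_measure.integrable_const_bound[OF that(2), of _ B]) auto
  have T_bound: "AE \<omega> in M. \<bar>T \<omega>\<bar> \<le> B * measure (N \<omega>) (space L)"
    using fin AE_space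
  proof eventually_elim
    case (elim \<omega>)
    interpret F: finite_measure "N \<omega>" by fact
    note sp = sets_eq_imp_space_eq[OF sets_prm[OF elim(2)]]
    have "\<bar>T \<omega>\<bar> \<le> (\<integral>\<xi>. B \<partial>N \<omega>)"
      unfolding T_def using B sp int_f elim by (intro integral_abs_le_integral) auto
    then show ?case by (simp add: sp mult.commute)
  qed
  have int_T: "integrable M T"
  proof (rule Bochner_Integration.integrable_bound)
    show "integrable M (\<lambda>\<omega>. B * measure (N \<omega>) (space L))" using tot(1) by simp
    show "T \<in> borel_measurable M" unfolding T_def[abs_def] by (rule measurable_integral_prm[OF f])
  qed (use T_bound in \<open>auto elim!: eventually_mono\<close>)
  then show "integrable M (\<lambda>\<omega>. \<integral>\<xi>. f \<xi> \<partial>N \<omega>)" unfolding T_def .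
  \<comment> \<open>The summands come from replacing \<open>T\<close> by \<open>S\<close>, from the
    variance, from the mean and from the third moment, in this order; \<open>l\<close> is the total
    mass.\<close>
  define K where "K = (1 + 8 * (2 * \<bar>B\<bar> + 1) + 3 + 6 * (3 * (\<bar>B\<bar> + 1)\<^sup>2)) * l"
  have approx: "\<bar>expectation (\<lambda>\<omega>. h (T \<omega>)) - m\<bar> \<le> 6 * (\<integral>\<xi>. \<bar>f \<xi>\<bar> ^ 3 \<partial>L) + K * e"
    if e: "0 < e" "e \<le> 1" for e
  proof -
    obtain A c and n :: nat where A: "\<And>i. A i \<in> sets L" "disjoint_family A" "space L = (\<Union>i<n. A i)"
      and c: "\<And>i \<xi>. \<xi> \<in> A i \<Longrightarrow> \<bar>f \<xi> - c i\<bar> \<le> e"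
      by (rule ex_level_set_partition[OF f B e(1)], assumption, (rule that; assumption))
    define S where "S \<omega> = (\<Sum>i<n. c i * measure (N \<omega>) (A i))" for \<omega>
    have int_S: "integrable M S"
      unfolding S_def[abs_def]
      by (intro Bochner_Integration.integrable_sum integrable_mult_right prm_counts_mean A finL)
    have "AE \<omega> in M. \<bar>T \<omega> - S \<omega>\<bar> \<le> e * measure (N \<omega>) (space L)"
      using fin AE_space
    proof eventually_elim
      case (elim \<omega>)
      note sp = sets_eq_imp_space_eq[OF sets_prm[OF elim(2)]]
      have "\<bar>T \<omega> - S \<omega>\<bar> \<le> e * measure (N \<omega>) (space (N \<omega>))"
        unfolding T_def S_def using A c
        by (intro partition_sum_integral_bound elim int_f) (simp_all add: sp sets_prm[OF elim(2)])
      then show ?case by (simp add: sp)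
    qed
    from expectation_lipschitz_diff[OF lip int_T int_S _ this]
    have TS: "\<bar>expectation (\<lambda>\<omega>. h (T \<omega>)) - expectation (\<lambda>\<omega>. h (S \<omega>))\<bar> \<le> e * l"
      using tot by (simp add: l_def)
    have S: "\<bar>expectation (\<lambda>\<omega>. h (S \<omega>)) - m\<bar> \<le> 8 * \<bar>1 - (\<Sum>i<n. (c i)\<^sup>2 * measure L (A i))\<bar>
        + 3 * \<bar>\<Sum>i<n. c i * measure L (A i)\<bar> + 6 * (\<Sum>i<n. \<bar>c i\<bar> ^ 3 * measure L (A i))"
      unfolding m_def S_def
      by (rule poisson_sum_normal_bound_smooth[OF _ prm_indep_counts[OF A(1,2)] prm_counts(1) h])
         (use A finL in auto)
    \<comment> \<open>A value \<open>c i\<close> is controlled only when its band contains a point,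
      and then by \<open>|B| + 1\<close> because \<open>e \<le> 1\<close>.\<close>
    have fc: "\<bar>f \<xi>\<bar> \<le> \<bar>B\<bar>" "\<bar>c i\<bar> \<le> \<bar>B\<bar> + 1" if "i < n" "\<xi> \<in> A i" for i \<xi>
    proof -
      have "\<xi> \<in> space L" using that A(3) by auto
      from B[OF this] show "\<bar>f \<xi>\<bar> \<le> \<bar>B\<bar>" by simp
      then show "\<bar>c i\<bar> \<le> \<bar>B\<bar> + 1" using c[OF that(2)] e by linarith
    qed
    have bounded: "integrable L (\<lambda>\<xi>. f \<xi> ^ k)" "integrable L (\<lambda>\<xi>. \<bar>f \<xi>\<bar> ^ k)" for k
    proof -
      have "\<bar>f \<xi>\<bar> ^ k \<le> B ^ k" if "\<xi> \<in> space L" for \<xi> using B[OF that] by (intro power_mono) auto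
      then show "integrable L (\<lambda>\<xi>. f \<xi> ^ k)" "integrable L (\<lambda>\<xi>. \<bar>f \<xi>\<bar> ^ k)"
        by (intro L.integrable_const_bound[of _ "B ^ k"]; simp add: power_abs)+
    qed
    have 1: "\<bar>0 - (\<Sum>i<n. c i * measure L (A i))\<bar> \<le> e * l"
      using partition_sum_integral_bound[OF L A, of f c e] bounded(1)[of 1] c
      by (simp add: f1 l_def)
    have "\<bar>(\<integral>\<xi>. (f \<xi>)\<^sup>2 \<partial>L) - (\<Sum>i<n. (c i)\<^sup>2 * measure L (A i))\<bar> \<le> e * (2 * \<bar>B\<bar> + 1) * measure L (space L)"
    proof (rule partition_sum_integral_bound[OF L A bounded(1)])
      fix i \<xi> assume i: "i < n" "\<xi> \<in> A i"
      have "\<bar>(f \<xi>)\<^sup>2 - (c i)\<^sup>2\<bar> = \<bar>f \<xi> - c i\<bar> * \<bar>f \<xi> + c i\<bar>"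
        by (simp add: power2_eq_square square_diff_square_factored abs_mult)
      also have "\<dots> \<le> e * (2 * \<bar>B\<bar> + 1)"
        using c[OF i(2)] fc[OF i] e by (intro mult_mono) auto
      finally show "\<bar>(f \<xi>)\<^sup>2 - (c i)\<^sup>2\<bar> \<le> e * (2 * \<bar>B\<bar> + 1)" .
    qed
    then have 2: "\<bar>1 - (\<Sum>i<n. (c i)\<^sup>2 * measure L (A i))\<bar> \<le> e * (2 * \<bar>B\<bar> + 1) * l"
      by (simp only: f2 l_def)
    have 3: "\<bar>(\<integral>\<xi>. \<bar>f \<xi>\<bar> ^ 3 \<partial>L) - (\<Sum>i<n. \<bar>c i\<bar> ^ 3 * measure L (A i))\<bar>
        \<le> e * (3 * (\<bar>B\<bar> + 1)\<^sup>2) * measure L (space L)"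
    proof (rule partition_sum_integral_bound[OF L A bounded(2)])
      fix i \<xi> assume i: "i < n" "\<xi> \<in> A i"
      let ?x = "\<bar>f \<xi>\<bar>" and ?y = "\<bar>c i\<bar>" and ?b = "\<bar>B\<bar> + 1"
      have xy: "?x \<le> ?b" "?y \<le> ?b" using fc[OF i] by auto
      have "?x ^ 3 - ?y ^ 3 = (?x - ?y) * (?x * ?x + ?x * ?y + ?y * ?y)"
        by (simp only: power3_eq_cube) (simp only: algebra_simps)
      then have "\<bar>?x ^ 3 - ?y ^ 3\<bar> = \<bar>?x - ?y\<bar> * (?x * ?x + ?x * ?y + ?y * ?y)"
        by (simp only: abs_mult) simp
      also have "\<dots> \<le> e * (?b * ?b + ?b * ?b + ?b * ?b)"
        using c[OF i(2)] xy e by (intro mult_mono add_mono) auto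
      finally show "\<bar>?x ^ 3 - ?y ^ 3\<bar> \<le> e * (3 * ?b\<^sup>2)" by (simp add: power2_eq_square)
    qed
    have combine: "\<bar>x - z\<bar> \<le> p + 8 * q + 3 * p + 6 * (I + r)"
      if "\<bar>x - y\<bar> \<le> p" "\<bar>y - z\<bar> \<le> 8 * \<bar>1 - s2\<bar> + 3 * \<bar>s1\<bar> + 6 * s3"
        "\<bar>0 - s1\<bar> \<le> p" "\<bar>1 - s2\<bar> \<le> q" "\<bar>I - s3\<bar> \<le> r" for x y z p q r s1 s2 s3 I :: real
    proof -
      have "s3 \<le> I + r" "\<bar>s1\<bar> \<le> p" using that(3,5) by linarith+
      then have "8 * \<bar>1 - s2\<bar> + 3 * \<bar>s1\<bar> + 6 * s3 \<le> 8 * q + 3 * p + 6 * (I + r)"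
        using that(4) by (intro add_mono mult_left_mono) auto
      with that(2) have "\<bar>y - z\<bar> \<le> 8 * q + 3 * p + 6 * (I + r)" by (rule order_trans)
      with that(1) show ?thesis by linarith
    qed
    have "6 * (\<integral>\<xi>. \<bar>f \<xi>\<bar> ^ 3 \<partial>L) + K * e = e * l + 8 * (e * (2 * \<bar>B\<bar> + 1) * l) + 3 * (e * l)
        + 6 * ((\<integral>\<xi>. \<bar>f \<xi>\<bar> ^ 3 \<partial>L) + e * (3 * (\<bar>B\<bar> + 1)\<^sup>2) * l)"
      unfolding K_def by (simp only: algebra_simps)
    then show ?thesis using combine[OF TS S 1 2 3[folded l_def]] by (simp only:)
  qed
  have "((\<lambda>e. 6 * (\<integral>\<xi>. \<bar>f \<xi>\<bar> ^ 3 \<partial>L) + K * e) \<longlongrightarrow> 6 * (\<integral>\<xi>. \<bar>f \<xi>\<bar> ^ 3 \<partial>L) + K * 0) (at_right 0)"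
    by (intro tendsto_intros)
  moreover have "\<forall>\<^sub>F e in at_right 0. \<bar>expectation (\<lambda>\<omega>. h (T \<omega>)) - m\<bar>
      \<le> 6 * (\<integral>\<xi>. \<bar>f \<xi>\<bar> ^ 3 \<partial>L) + K * e"
    unfolding eventually_at_right_field using approx by (intro exI[of _ 1]) auto
  ultimately have "\<bar>expectation (\<lambda>\<omega>. h (T \<omega>)) - m\<bar> \<le> 6 * (\<integral>\<xi>. \<bar>f \<xi>\<bar> ^ 3 \<partial>L) + K * 0"
    by (rule tendsto_lowerbound) simp
  then show "\<bar>expectation (\<lambda>\<omega>. h (\<integral>\<xi>. f \<xi> \<partial>N \<omega>)) - (\<integral>z. std_normal_density z * h z \<partial>lborel)\<bar>
      \<le> 6 * (\<integral>\<xi>. \<bar>f \<xi>\<bar> ^ 3 \<partial>L)"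
    unfolding T_def m_def by simp
qed

text \<open>The smooth bound depends on the test function only through its Lipschitz constant, so
  \<open>h\<close> can be replaced by smooth functions uniformly within \<open>e / 2\<close>. The
  replacement costs \<open>e / 2\<close> under the law of the integral and \<open>e / 2\<close>
  under the Gaussian law.\<close>

lemma prm_integral_normal_bound:
  fixes f :: "'b \<Rightarrow> real" and h :: "real \<Rightarrow> real"
  assumes L: "finite_measure L" and f: "f \<in> borel_measurable L"
    and B: "\<And>\<xi>. \<xi> \<in> space L \<Longrightarrow> \<bar>f \<xi>\<bar> \<le> B"
    and f1: "(\<integral>\<xi>. f \<xi> \<partial>L) = 0" and f2: "(\<integral>\<xi>. (f \<xi>)\<^sup>2 \<partial>L) = 1"
    and h: "1-lipschitz_on UNIV h"
  shows "\<bar>expectation (\<lambda>\<omega>. h (\<integral>\<xi>. f \<xi> \<partial>N \<omega>)) - (\<integral>z. std_normal_density z * h z \<partial>lborel)\<bar>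
      \<le> 6 * (\<integral>\<xi>. \<bar>f \<xi>\<bar> ^ 3 \<partial>L)"
proof (rule field_le_epsilon)
  fix e :: real assume "0 < e"
  then obtain k k' where Dk: "\<And>x. (k has_real_derivative k' x) (at x)" and k': "\<And>x. \<bar>k' x\<bar> \<le> 1"
    and kh: "\<And>x. \<bar>k x - h x\<bar> \<le> e / 2"
    using ex_smooth_lipschitz_approx[OF h, of "e / 2"] by (metis half_gt_zero)
  have k: "1-lipschitz_on UNIV k"
    by (rule lipschitz_on_of_derivative[OF Dk k'])
  define T where "T \<omega> = (\<integral>\<xi>. f \<xi> \<partial>N \<omega>)" for \<omega>
  note smooth = prm_integral_normal_bound_smooth[OF L f B f1 f2 Dk k' k, folded T_def]
  note int_k = integrable_lipschitz_comp[OF k smooth(1)]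
    and int_h = integrable_lipschitz_comp[OF h smooth(1)]
  have "\<bar>expectation (\<lambda>\<omega>. k (T \<omega>) - h (T \<omega>))\<bar> \<le> e / 2"
    using int_k int_h kh by (intro abs_expectation_le) auto
  then have 1: "\<bar>expectation (\<lambda>\<omega>. k (T \<omega>)) - expectation (\<lambda>\<omega>. h (T \<omega>))\<bar> \<le> e / 2"
    using int_k int_h by simp
  have "\<bar>\<integral>z. std_normal_density z * k z - std_normal_density z * h z \<partial>lborel\<bar>
      \<le> (\<integral>z. std_normal_density z * (e / 2) \<partial>lborel)"
  proof (rule integral_abs_le_integral)
    show "integrable lborel (\<lambda>z. std_normal_density z * k z - std_normal_density z * h z)"
      using std_normal_abs_diff_le(1)[OF k] std_normal_abs_diff_le(1)[OF h] by simp
    show "integrable lborel (\<lambda>z. std_normal_density z * (e / 2))"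
      using integrable_std_normal_moment[of 0] by simp
    show "\<bar>std_normal_density z * k z - std_normal_density z * h z\<bar> \<le> std_normal_density z * (e / 2)" for z
      unfolding right_diff_distrib[symmetric] abs_mult using mult_left_mono[OF kh[of z], of "std_normal_density z"] by simp
  qed
  then have 2: "\<bar>(\<integral>z. std_normal_density z * k z \<partial>lborel) - (\<integral>z. std_normal_density z * h z \<partial>lborel)\<bar> \<le> e / 2"
    using std_normal_abs_diff_le(1)[OF k] std_normal_abs_diff_le(1)[OF h]
      integral_std_normal_moment_even[of 0] by simp
  show "\<bar>expectation (\<lambda>\<omega>. h (\<integral>\<xi>. f \<xi> \<partial>N \<omega>)) - (\<integral>z. std_normal_density z * h z \<partial>lborel)\<bar>
      \<le> 6 * (\<integral>\<xi>. \<bar>f \<xi>\<bar> ^ 3 \<partial>L) + e"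
    using smooth(2) 1 2 unfolding T_def by linarith
qed

end

section \<open>Legendre polynomials\<close>

lemma has_integral_poly_pderiv:
  fixes p :: "real poly"
  assumes "a \<le> b"
  shows "((\<lambda>u. poly (pderiv p) u) has_integral poly p b - poly p a) {a..b}"
  using assms
  by (intro fundamental_theorem_of_calculus)
     (auto simp flip: has_real_derivative_iff_has_vector_derivative
       intro!: has_field_derivative_at_within poly_DERIV)

definition square_minus_one :: "real poly" where
  "square_minus_one = [:- 1, 0, 1:]"

lemma poly_square_minus_one [simp]: "poly square_minus_one u = u\<^sup>2 - 1"
  by (simp add: square_minus_one_def power2_eq_square)

lemma pderiv_square_minus_one [simp]: "pderiv square_minus_one = [:0, 2:]"
  by (simp add: square_minus_one_def pderiv_pCons)

definition rodrigues :: "nat \<Rightarrow> real poly" where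
  "rodrigues l = square_minus_one ^ l"

lemma pderiv_rodrigues: "square_minus_one * pderiv (rodrigues l) = smult (2 * real l) ([:0, 1:] * rodrigues l)"
proof (cases l)
  case (Suc n)
  then show ?thesis
    by (intro poly_ext) (simp only: rodrigues_def pderiv_power_Suc, simp add: algebra_simps)
qed (simp add: rodrigues_def)

text \<open>This is \<open>pderiv_rodrigues\<close> differentiated \<open>n + 1\<close> times;
  induction replaces the Leibniz rule. At \<open>n = l\<close> it becomes Legendre's equation for
  the unnormalised polynomial.\<close>

lemma rodrigues_higher_deriv:
  "(u\<^sup>2 - 1) * poly ((pderiv ^^ Suc (Suc n)) (rodrigues l)) u
    = 2 * (real l - real n - 1) * u * poly ((pderiv ^^ Suc n) (rodrigues l)) u
      + (real n + 1) * (2 * real l - real n) * poly ((pderiv ^^ n) (rodrigues l)) u"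
proof -
  have "square_minus_one * (pderiv ^^ Suc (Suc n)) (rodrigues l)
    = smult (2 * (real l - real n - 1)) ([:0, 1:] * (pderiv ^^ Suc n) (rodrigues l))
      + smult ((real n + 1) * (2 * real l - real n)) ((pderiv ^^ n) (rodrigues l))" (is "?L n = ?R n")
  proof (induction n)
    case 0
    have "poly (pderiv (square_minus_one * pderiv (rodrigues l))) x
        = poly (pderiv (smult (2 * real l) ([:0, 1:] * rodrigues l))) x" for x
      by (simp only: pderiv_rodrigues)
    then have "poly (?L 0) x = poly (?R 0) x" for x
      by (simp add: pderiv_mult pderiv_smult pderiv_pCons algebra_simps)
    then show ?case by (intro poly_ext) simp
  next
    case (Suc n)
    have "poly (pderiv (?L n)) x = poly (pderiv (?R n)) x" for x
      by (simp only: Suc)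
    then have "poly (?L (Suc n)) x = poly (?R (Suc n)) x" for x
      by (simp add: pderiv_mult pderiv_smult pderiv_add pderiv_pCons algebra_simps)
    then show ?case by (intro poly_ext) simp
  qed
  from arg_cong[OF this, of "\<lambda>p. poly p u"] show ?thesis
    by (simp add: algebra_simps power2_eq_square)
qed

lemma legendre_ode:
  "(1 - u\<^sup>2) * poly (pderiv (pderiv (legendre l))) u
    = 2 * u * poly (pderiv (legendre l)) u - real l * (real l + 1) * poly (legendre l) u"
proof -
  define c where "c = 1 / (2 ^ l * fact l :: real)"
  have L: "legendre l = smult c ((pderiv ^^ l) (rodrigues l))"
    by (simp add: legendre_def rodrigues_def square_minus_one_def c_def)
  have eq: "(u\<^sup>2 - 1) * poly (pderiv (pderiv ((pderiv ^^ l) (rodrigues l)))) u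
      = - 2 * u * poly (pderiv ((pderiv ^^ l) (rodrigues l))) u
        + (real l + 1) * real l * poly ((pderiv ^^ l) (rodrigues l)) u"
    using rodrigues_higher_deriv[of u l l] by simp
  have "(1 - u\<^sup>2) * poly (pderiv (pderiv (legendre l))) u
      = - c * ((u\<^sup>2 - 1) * poly (pderiv (pderiv ((pderiv ^^ l) (rodrigues l)))) u)"
    by (simp add: L pderiv_smult algebra_simps)
  also have "\<dots> = 2 * u * poly (pderiv (legendre l)) u - real l * (real l + 1) * poly (legendre l) u"
    unfolding eq by (simp add: L pderiv_smult algebra_simps)
  finally show ?thesis .
qed

text \<open>In divergence form Legendre's equation says that \<open>l * (l + 1) * P\<close> is the
  derivative of \<open>(u^2 - 1) * P'\<close>, which vanishes at both ends. This is the centring of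
  the wave.\<close>

lemma integral_legendre_eq_0:
  assumes "0 < l"
  shows "(poly (legendre l) has_integral 0) {-1..1}"
proof -
  let ?p = "square_minus_one * pderiv (legendre l)"
  have "poly (pderiv ?p) u = (real l * (real l + 1)) * poly (legendre l) u" for u
    using legendre_ode[of u l] by (simp add: pderiv_mult algebra_simps)
  with has_integral_poly_pderiv[of "-1" 1 ?p]
  have "((\<lambda>u. (real l * (real l + 1)) * poly (legendre l) u) has_integral 0) {-1..1}"
    by simp
  from has_integral_mult_right[OF this, of "1 / (real l * (real l + 1))"] assms
  show ?thesis by (simp add: add_eq_0_iff_both_eq_0)
qed

text \<open>Each derivative lowers the order of the zeros at -1 and 1 by one, so after
  \<open>n < l\<close> of them a power of \<open>u^2 - 1\<close> is still a factor.\<close>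

lemma rodrigues_deriv_at_ends:
  assumes "n < l" "u\<^sup>2 = 1"
  shows "poly ((pderiv ^^ n) (rodrigues l)) u = 0"
proof -
  have "\<exists>q. (pderiv ^^ n) (rodrigues l) = square_minus_one ^ (l - n) * q"
    using assms(1)
  proof (induction n)
    case 0
    then show ?case by (intro exI[of _ 1]) (simp add: rodrigues_def)
  next
    case (Suc n)
    then obtain q where q: "(pderiv ^^ n) (rodrigues l) = square_minus_one ^ (l - n) * q" by auto
    define m where "m = l - Suc n"
    have m: "l - n = Suc m" using Suc.prems by (simp add: m_def)
    have "(pderiv ^^ Suc n) (rodrigues l)
        = square_minus_one ^ m * (smult (real m + 1) (pderiv square_minus_one) * q + square_minus_one * pderiv q)"
      by (simp only: funpow.simps o_apply q m pderiv_mult pderiv_power_Suc) (simp add: algebra_simps smult_add_left)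
    then show ?case unfolding m_def by blast
  qed
  then obtain q where "(pderiv ^^ n) (rodrigues l) = square_minus_one ^ (l - n) * q" ..
  then show ?thesis using assms by (simp add: poly_power power2_eq_square)
qed

text \<open>Integrating the derivative of \<open>u * (1 - u^2) ^ (l + 1)\<close>, whose boundary
  values vanish, gives the recursion \<open>(2 l + 3) J(l + 1) = 2 (l + 1) J(l)\<close>.\<close>

lemma integral_one_minus_square_power:
  "((\<lambda>u. (1 - u\<^sup>2) ^ l) has_integral 2 ^ (2 * l + 1) * (fact l)\<^sup>2 / fact (2 * l + 1)) {-1..1::real}"
proof (induction l)
  case 0
  show ?case using has_integral_const_real[of "1::real" "-1" 1] by simp
next
  case (Suc l)
  define J where "J = (2 ^ (2 * l + 1) * (fact l)\<^sup>2 / fact (2 * l + 1) :: real)"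
  note IH = Suc[folded J_def]
  have "((\<lambda>u. (2 * real l + 3) * (1 - u\<^sup>2) ^ Suc l - 2 * (real l + 1) * (1 - u\<^sup>2) ^ l)
      has_integral 1 * (1 - 1\<^sup>2) ^ Suc l - (- 1) * (1 - (- 1)\<^sup>2) ^ Suc l) {-1..1::real}"
  proof (rule fundamental_theorem_of_calculus)
    fix u :: real
    have "((\<lambda>u. u * (1 - u\<^sup>2) ^ Suc l) has_real_derivative
        (1 - u\<^sup>2) ^ Suc l + u * (real (Suc l) * (1 - u\<^sup>2) ^ l * (- (2 * u)))) (at u within {-1..1})"
      by (auto intro!: derivative_eq_intros simp del: power_Suc)
    also have "(1 - u\<^sup>2) ^ Suc l + u * (real (Suc l) * (1 - u\<^sup>2) ^ l * (- (2 * u)))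
        = (2 * real l + 3) * (1 - u\<^sup>2) ^ Suc l - 2 * (real l + 1) * (1 - u\<^sup>2) ^ l"
      by (simp add: algebra_simps power2_eq_square)
    finally show "((\<lambda>u. u * (1 - u\<^sup>2) ^ Suc l) has_vector_derivative
        (2 * real l + 3) * (1 - u\<^sup>2) ^ Suc l - 2 * (real l + 1) * (1 - u\<^sup>2) ^ l) (at u within {-1..1})"
      by (simp add: has_real_derivative_iff_has_vector_derivative)
  qed simp
  from has_integral_add[OF this has_integral_mult_right[OF IH, of "2 * (real l + 1)"]]
  have "((\<lambda>u. (2 * real l + 3) * (1 - u\<^sup>2) ^ Suc l) has_integral 2 * (real l + 1) * J) {-1..1::real}"
    by (simp del: power_Suc)
  from has_integral_mult_right[OF this, of "1 / (2 * real l + 3)"]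
  have "((\<lambda>u. (1 - u\<^sup>2) ^ Suc l) has_integral 2 * (real l + 1) * J / (2 * real l + 3)) {-1..1::real}"
    by (simp add: add_nonneg_eq_0_iff del: power_Suc)
  also have "2 * (real l + 1) * J / (2 * real l + 3)
      = 2 ^ (2 * Suc l + 1) * (fact (Suc l))\<^sup>2 / fact (2 * Suc l + 1)"
  proof -
    have f: "fact (2 * Suc l + 1) = (2 * real l + 3) * (2 * (real l + 1)) * fact (2 * l + 1)"
      by (simp add: algebra_simps)
    have p: "2 ^ (2 * Suc l + 1) * (fact (Suc l))\<^sup>2
        = (2 * (real l + 1)) * (2 * (real l + 1)) * (2 ^ (2 * l + 1) * (fact l)\<^sup>2 :: real)"
      by (simp add: power2_eq_square algebra_simps)
    have c: "2 * a * (Y / Z) / b = (2 * a) * (2 * a) * Y / (b * (2 * a) * Z)"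
      if "a \<noteq> 0" "b \<noteq> 0" "Z \<noteq> 0" for a b Y Z :: real
      using that by (simp add: field_simps)
    show ?thesis unfolding f p J_def by (rule c) auto
  qed
  finally show ?case .
qed

lemma rodrigues_deriv_full: "poly ((pderiv ^^ (2 * l)) (rodrigues l)) u = fact (2 * l)"
proof -
  have deg: "degree (rodrigues l) = 2 * l" and lead: "coeff (rodrigues l) (2 * l) = 1"
  proof -
    show deg: "degree (rodrigues l) = 2 * l"
      unfolding rodrigues_def by (subst degree_power_eq) (auto simp: square_minus_one_def)
    have "lead_coeff (rodrigues l) = 1" unfolding rodrigues_def lead_coeff_power by (simp add: square_minus_one_def)
    with deg show "coeff (rodrigues l) (2 * l) = 1" by simp
  qed
  have "degree ((pderiv ^^ (2 * l)) (rodrigues l)) = 0"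
    by (simp add: degree_higher_pderiv deg)
  then obtain c where c: "(pderiv ^^ (2 * l)) (rodrigues l) = [:c:]"
    by (rule degree_eq_zeroE)
  have "coeff ((pderiv ^^ (2 * l)) (rodrigues l)) 0 = pochhammer 1 (2 * l)"
    by (simp add: coeff_higher_pderiv lead)
  then show ?thesis by (simp add: c pochhammer_fact)
qed

lemma integral_legendre_square:
  "((\<lambda>u. (poly (legendre l) u)\<^sup>2) has_integral 2 / (2 * real l + 1)) {-1..1}"
proof -
  let ?D = "\<lambda>n. (pderiv ^^ n) (rodrigues l)"
  define J where "J = fact (2 * l) * (2 ^ (2 * l + 1) * (fact l)\<^sup>2 / fact (2 * l + 1) :: real)"
  \<comment> \<open>Repeated integration by parts. Each step moves one derivative to the other
    factor and flips the sign; boundary terms vanish since fewer than \<open>l\<close> derivatives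
    remain on the first factor. The induction descends from \<open>k = l\<close>, where the second
    factor is the constant \<open>fact (2 * l)\<close>.\<close>
  have parts: "((\<lambda>u. poly (?D (l - k)) u * poly (?D (l + k)) u) has_integral
      (- 1) ^ (l - k) * ((- 1) ^ l * J)) {-1..1}"
    if "k \<le> l" for k
    using that
  proof (induction rule: inc_induct)
    case base
    have "poly (rodrigues l) u = (- 1) ^ l * (1 - u\<^sup>2) ^ l" for u
      by (simp add: rodrigues_def poly_power power2_eq_square flip: power_mult_distrib)
    then have "poly (?D (l - l)) u * poly (?D (l + l)) u = fact (2 * l) * ((- 1) ^ l * (1 - u\<^sup>2) ^ l)" for u
      using rodrigues_deriv_full[of l u] by (simp flip: mult_2)
    with has_integral_mult_right[OF has_integral_mult_right[OF integral_one_minus_square_power[of l],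
        of "(-1) ^ l"], of "fact (2 * l)"]
    show ?case by (simp add: J_def mult_ac)
  next
    case (step k)
    let ?p = "?D (l - Suc k) * ?D (l + k)"
    have D: "pderiv (?D (l - Suc k)) = ?D (l - k)"
      using step by (metis Suc_diff_Suc funpow.simps(2) o_apply Suc_le_eq)
    have "((\<lambda>u. poly (pderiv ?p) u) has_integral poly ?p 1 - poly ?p (- 1)) {-1..1}"
      by (rule has_integral_poly_pderiv) simp
    moreover have "poly ?p 1 - poly ?p (- 1) = 0"
      using step by (simp add: rodrigues_deriv_at_ends)
    moreover have "poly (pderiv ?p) u = poly (?D (l - k)) u * poly (?D (l + k)) u
        + poly (?D (l - Suc k)) u * poly (?D (l + Suc k)) u" for u
      by (simp add: pderiv_mult D algebra_simps)
    ultimately have "((\<lambda>u. poly (?D (l - k)) u * poly (?D (l + k)) u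
        + poly (?D (l - Suc k)) u * poly (?D (l + Suc k)) u) has_integral 0) {-1..1}" by simp
    from has_integral_diff[OF this step.IH]
    have "((\<lambda>u. poly (?D (l - k)) u * poly (?D (l + k)) u) has_integral
      - ((- 1) ^ (l - Suc k) * ((- 1) ^ l * J))) {-1..1}"
      by simp
    moreover have "(- 1 :: real) ^ (l - k) = - ((- 1) ^ (l - Suc k))"
      using step by (metis Suc_diff_Suc Suc_le_eq mult_minus1 power_Suc)
    ultimately show ?case by simp
  qed
  have "((\<lambda>u. poly (?D l) u * poly (?D l) u) has_integral J) {-1..1}"
    using parts[of 0] by simp
  from has_integral_mult_right[OF this, of "(1 / (2 ^ l * fact l))\<^sup>2"]
  have "((\<lambda>u. (poly (legendre l) u)\<^sup>2) has_integral (1 / (2 ^ l * fact l))\<^sup>2 * J) {-1..1}"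
    by (simp add: legendre_def rodrigues_def square_minus_one_def power2_eq_square mult_ac)
  also have "(1 / (2 ^ l * fact l))\<^sup>2 * J = 2 / (2 * real l + 1)"
  proof -
    have "fact (2 * l + 1) = (2 * real l + 1) * fact (2 * l)" by (simp add: algebra_simps)
    moreover have "(2 :: real) ^ (2 * l + 1) = 2 * (2 ^ l)\<^sup>2" by (simp add: mult.commute flip: power_mult)
    moreover have "fact (2 * l) \<noteq> (0 :: real)" "2 * real l + 1 \<noteq> 0" by simp_all
    ultimately show ?thesis unfolding J_def by (simp add: power_divide power_mult_distrib)
  qed
  finally show ?thesis .
qed

text \<open>
  With \<open>u = cos \<theta>\<close>, the function \<open>v(\<theta>) = (sin \<theta>)\<^sup>1\<^sup>/\<^sup>2 P(cos \<theta>)\<close> satisfies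
  \<open>v'' + \<phi> v = 0\<close> with \<open>\<phi> = (l + 1/2)\<^sup>2 + 1 / (4 sin\<^sup>2 \<theta>)\<close>. Sonin's function is
  \<open>v\<^sup>2 + v'\<^sup>2 / \<phi>\<close>, whose derivative \<open>- v'\<^sup>2 \<phi>' / \<phi>\<^sup>2\<close> has the sign of \<open>- \<phi>'\<close>.
\<close>

definition sonin :: "nat \<Rightarrow> real \<Rightarrow> real" where
  "sonin l u = sqrt (1 - u\<^sup>2) * ((poly (legendre l) u)\<^sup>2
     + ((1 - u\<^sup>2) * poly (pderiv (legendre l)) u - u * poly (legendre l) u / 2)\<^sup>2
       / ((real l * (real l + 1) + 1 / 4) * (1 - u\<^sup>2) + 1 / 4))"

text \<open>The computation stays in the variable \<open>u\<close>. In terms of the angle,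
  \<open>s\<close> is sin \<theta>, \<open>Q\<close> is \<phi> times the square of sin \<theta>, and
  \<open>R\<close> is minus \<open>v'\<close> times the square root of sin \<theta>. The nonnegative
  factor is \<open>d = R^2 / (2 * s * Q^2)\<close>.\<close>

lemma sonin_has_derivative:
  assumes u: "\<bar>u\<bar> < 1"
  obtains d where "(sonin l has_real_derivative - u * d) (at u)" "0 \<le> d"
proof -
  define p where "p = poly (legendre l)"
  define p1 where "p1 = poly (pderiv (legendre l))"
  define p2 where "p2 = poly (pderiv (pderiv (legendre l)))"
  define L where "L = real l * (real l + 1)"
  define w where "w = (\<lambda>u::real. 1 - u\<^sup>2)"
  define R where "R = (\<lambda>u. w u * p1 u - u * p u / 2)"
  define Q where "Q = (\<lambda>u. (L + 1 / 4) * w u + 1 / 4)"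
  define R' where "R' = - L * p u - p u / 2 - u * p1 u / 2"
  have L: "0 \<le> L" by (simp add: L_def)
  have w: "0 < w u" using u by (simp add: w_def abs_square_less_1)
  define s where "s = sqrt (w u)"
  have s: "0 < s" "s\<^sup>2 = w u" using w by (simp_all add: s_def)
  have Q: "0 < Q u" using w L unfolding Q_def by (intro add_nonneg_pos mult_nonneg_nonneg) auto
  have Dp: "(p has_real_derivative p1 u) (at u)" "(p1 has_real_derivative p2 u) (at u)"
    unfolding p_def p1_def p2_def by (rule poly_DERIV)+
  have ode: "w u * p2 u = 2 * u * p1 u - L * p u"
    using legendre_ode[of u l] by (simp add: w_def p_def p1_def p2_def L_def)
  have Dw: "(w has_real_derivative - 2 * u) (at u)"
    unfolding w_def by (auto intro!: derivative_eq_intros)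
  have "(R has_real_derivative (- 2 * u) * p1 u + p2 u * w u - (p u + p1 u * u) / 2) (at u)"
    unfolding R_def by (auto intro!: derivative_eq_intros Dw Dp)
  also have "(- 2 * u) * p1 u + p2 u * w u - (p u + p1 u * u) / 2 = R'"
    using ode by (simp add: R'_def field_simps)
  finally have DR: "(R has_real_derivative R') (at u)" .
  have DQ: "(Q has_real_derivative (L + 1 / 4) * (- 2 * u)) (at u)"
    unfolding Q_def by (auto intro!: derivative_eq_intros Dw)
  have Ds: "((\<lambda>u. sqrt (w u)) has_real_derivative - u / s) (at u)"
    using DERIV_chain2[OF DERIV_real_sqrt[OF w] Dw] by (simp add: s_def field_simps)
  have sonin: "sonin l = (\<lambda>u. sqrt (w u) * ((p u)\<^sup>2 + (R u)\<^sup>2 / Q u))"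
    by (simp add: fun_eq_iff sonin_def w_def p_def p1_def R_def Q_def L_def)
  define d0 where "d0 = (- u / s) * ((p u)\<^sup>2 + (R u)\<^sup>2 / Q u)
      + s * (2 * p u * p1 u + (2 * R u * R' * Q u - (R u)\<^sup>2 * ((L + 1 / 4) * (- 2 * u))) / (Q u)\<^sup>2)"
  have D: "(sonin l has_real_derivative d0) (at u)"
  proof -
    have A: "((\<lambda>u. (p u)\<^sup>2) has_real_derivative 2 * p u * p1 u) (at u)"
      by (auto intro!: derivative_eq_intros Dp)
    have B: "((\<lambda>u. (R u)\<^sup>2 / Q u) has_real_derivative
        (2 * R u * R' * Q u - (R u)\<^sup>2 * ((L + 1 / 4) * (- 2 * u))) / (Q u)\<^sup>2) (at u)"
      using Q by (auto intro!: derivative_eq_intros DR DQ simp: power2_eq_square)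
    show ?thesis
      unfolding sonin d0_def using DERIV_mult[OF Ds DERIV_add[OF A B]] by (simp add: s_def mult.commute)
  qed
  \<comment> \<open>The equation \<open>v'' + \<phi> v = 0\<close>, rewritten in \<open>u\<close>,
    \<open>R\<close> and \<open>Q\<close>.\<close>
  have key: "u * R u + 2 * Q u * p u + 2 * w u * R' = 0"
    by (simp add: R_def Q_def R'_def w_def power2_eq_square field_simps)
  have "s * (Q u)\<^sup>2 * d0 = - u * ((p u)\<^sup>2 * (Q u)\<^sup>2 + (R u)\<^sup>2 * Q u)
      + s\<^sup>2 * (2 * p u * p1 u * (Q u)\<^sup>2 + (2 * R u * R' * Q u - (R u)\<^sup>2 * ((L + 1 / 4) * (- 2 * u))))"
    using s(1) Q by (simp add: d0_def field_simps power2_eq_square)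
  \<comment> \<open>The derivative of \<open>P\<close> is eliminated through \<open>R\<close>; what
    remains, apart from \<open>- u * R^2 / 2\<close>, is a multiple of the expression in
    \<open>key\<close>.\<close>
  also have "\<dots> = - u * (R u)\<^sup>2 / 2 + Q u * R u * (u * R u + 2 * Q u * p u + 2 * w u * R')"
    unfolding s(2) by (simp add: R_def Q_def power2_eq_square field_simps)
  finally have "s * (Q u)\<^sup>2 * d0 = - u * (R u)\<^sup>2 / 2" unfolding key by simp
  then have "d0 = - u * ((R u)\<^sup>2 / (2 * s * (Q u)\<^sup>2))"
    using s(1) Q by (simp add: field_simps)
  with D have "(sonin l has_real_derivative - u * ((R u)\<^sup>2 / (2 * s * (Q u)\<^sup>2))) (at u)" by simp
  then show ?thesis by (rule that) (use s(1) in simp)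
qed

lemma sonin_le_sonin_0:
  assumes "\<bar>u\<bar> < 1"
  shows "sonin l u \<le> sonin l 0"
proof (cases "0 \<le> u")
  case True
  show ?thesis
  proof (rule DERIV_nonpos_imp_nonincreasing[OF True])
    fix x assume x: "0 \<le> x" "x \<le> u"
    with assms have "\<bar>x\<bar> < 1" by simp
    then obtain d where "(sonin l has_real_derivative - x * d) (at x)" "0 \<le> d"
      by (rule sonin_has_derivative)
    with x show "\<exists>y. (sonin l has_real_derivative y) (at x) \<and> y \<le> 0"
      by (intro exI[of _ "- x * d"]) auto
  qed
next
  case False
  show ?thesis
  proof (rule DERIV_nonneg_imp_nondecreasing[of u 0])
    fix x assume x: "u \<le> x" "x \<le> 0"
    with assms have "\<bar>x\<bar> < 1" by simp
    then obtain d where "(sonin l has_real_derivative - x * d) (at x)" "0 \<le> d"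
      by (rule sonin_has_derivative)
    with x show "\<exists>y. (sonin l has_real_derivative y) (at x) \<and> 0 \<le> y"
      by (intro exI[of _ "- x * d"]) (auto simp: mult_nonpos_nonneg)
  qed (use False in simp)
qed

text \<open>The value at the equator is bounded through the square norm instead of explicit central
  values: the integral of \<open>2 * L * u * P^2\<close> over \<open>{0..1}\<close> is at most
  \<open>2 * L\<close> times that of \<open>P^2\<close> over the whole interval.\<close>

lemma sonin_0_le:
  assumes "0 < l"
  shows "sonin l 0 \<le> 4 / (2 * real l + 1)"
proof -
  define P where "P = legendre l"
  define L where "L = real l * (real l + 1)"
  have L: "0 < L" using assms by (simp add: L_def)
  \<comment> \<open>\<open>G = L (1 - u\<^sup>2) P\<^sup>2 + ((1 - u\<^sup>2) P')\<^sup>2\<close> vanishes at \<open>1\<close>, so its value at \<open>0\<close> is the integral of \<open>- G'\<close>.\<close>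
  let ?G = "smult L ([:1, 0, - 1:] * P * P) + [:1, 0, - 1:] * pderiv P * ([:1, 0, - 1:] * pderiv P)"
  have G': "poly (pderiv ?G) u = - 2 * u * L * (poly P u)\<^sup>2" for u
  proof -
    have ode: "(1 - u\<^sup>2) * poly (pderiv (pderiv P)) u = 2 * u * poly (pderiv P) u - L * poly P u"
      using legendre_ode[of u l] by (simp add: P_def L_def)
    have W: "poly (pderiv [:1, 0, - 1 :: real:]) u = - 2 * u" "poly [:1, 0, - 1 :: real:] u = 1 - u\<^sup>2"
      by (simp_all add: pderiv_pCons power2_eq_square)
    have "poly (pderiv ?G) u = L * ((- 2 * u) * (poly P u)\<^sup>2 + 2 * (1 - u\<^sup>2) * poly P u * poly (pderiv P) u)
        + 2 * ((1 - u\<^sup>2) * poly (pderiv P) u)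
          * ((- 2 * u) * poly (pderiv P) u + (1 - u\<^sup>2) * poly (pderiv (pderiv P)) u)"
      unfolding pderiv_add pderiv_smult pderiv_mult poly_add poly_smult poly_mult W
      by (simp only: power2_eq_square algebra_simps)
    also have "\<dots> = - 2 * u * L * (poly P u)\<^sup>2"
      unfolding ode by (simp add: power2_eq_square algebra_simps)
    finally show ?thesis .
  qed
  have "((\<lambda>u. - 2 * u * L * (poly P u)\<^sup>2) has_integral poly ?G 1 - poly ?G 0) {0..1}"
    using has_integral_poly_pderiv[of 0 1 ?G] unfolding G' by simp
  from has_integral_neg[OF this]
  have G: "((\<lambda>u. 2 * L * (u * (poly P u)\<^sup>2)) has_integral L * (poly P 0)\<^sup>2 + (poly (pderiv P) 0)\<^sup>2) {0..1}"
    by (simp add: power2_eq_square mult_ac add_ac)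
  have int: "((\<lambda>u. (poly P u)\<^sup>2) has_integral 2 / (2 * real l + 1)) {-1..1}"
    unfolding P_def by (rule integral_legendre_square)
  have "(\<lambda>u. (poly P u)\<^sup>2) integrable_on {0..1}"
    by (rule integrable_on_subinterval[OF has_integral_integrable[OF int]]) auto
  then obtain I where I: "((\<lambda>u. (poly P u)\<^sup>2) has_integral I) {0..1}" by auto
  have "I \<le> 2 / (2 * real l + 1)"
    by (rule has_integral_subset_le[OF _ I int]) auto
  moreover have "L * (poly P 0)\<^sup>2 + (poly (pderiv P) 0)\<^sup>2 \<le> 2 * L * I"
  proof (rule has_integral_le[OF G has_integral_mult_right[OF I]])
    fix u :: real assume "u \<in> {0..1}"
    then show "2 * L * (u * (poly P u)\<^sup>2) \<le> 2 * L * (poly P u)\<^sup>2"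
      using L by (intro mult_left_mono) (auto intro: mult_left_le_one_le)
  qed
  ultimately have "L * (poly P 0)\<^sup>2 + (poly (pderiv P) 0)\<^sup>2 \<le> 2 * L * (2 / (2 * real l + 1))"
    using L by (smt (verit) mult_left_mono)
  then have "((poly P 0)\<^sup>2 + (poly (pderiv P) 0)\<^sup>2 / L) \<le> 4 / (2 * real l + 1)"
    using L by (simp add: field_simps)
  \<comment> \<open>At \<open>u = 0\<close> the denominator in \<open>sonin\<close> is
    \<open>L + 1 / 2\<close>, which may be lowered to \<open>L\<close>.\<close>
  moreover have "(poly (pderiv P) 0)\<^sup>2 / (L + 1 / 4 + 1 / 4) \<le> (poly (pderiv P) 0)\<^sup>2 / L"
    using L by (intro divide_left_mono) auto
  ultimately show ?thesis by (simp add: sonin_def P_def L_def)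
qed

section \<open>Pointwise bound and third absolute moment\<close>

lemma legendre_bernstein:
  assumes "0 < l" "\<bar>u\<bar> < 1"
  shows "sqrt (1 - u\<^sup>2) * (poly (legendre l) u)\<^sup>2 \<le> 4 / (2 * real l + 1)"
proof -
  have "0 \<le> 1 - u\<^sup>2" using assms(2) by (simp add: abs_square_less_1 less_imp_le)
  then have "sqrt (1 - u\<^sup>2) * (poly (legendre l) u)\<^sup>2 \<le> sonin l u"
    unfolding sonin_def by (intro mult_left_mono) (auto intro!: divide_nonneg_nonneg add_nonneg_nonneg)
  also have "\<dots> \<le> sonin l 0" by (rule sonin_le_sonin_0[OF assms(2)])
  also have "\<dots> \<le> 4 / (2 * real l + 1)" by (rule sonin_0_le[OF assms(1)])
  finally show ?thesis .
qed

text \<open>The preceding bound raised to the power 3/2, with \<open>1 - u^2\<close> replaced by the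
  smaller \<open>1 - |u|\<close>. The exponent -3/4 is the product of -1/2 and 3/2.\<close>

lemma legendre_cube_bound:
  assumes "0 < l" "\<bar>u\<bar> < 1"
  shows "\<bar>poly (legendre l) u\<bar> ^ 3 \<le> (4 / (2 * real l + 1)) powr (3 / 2) * (1 - \<bar>u\<bar>) powr (- 3 / 4)"
proof -
  define p where "p = \<bar>poly (legendre l) u\<bar>"
  define w where "w = 1 - \<bar>u\<bar>"
  define c where "c = 4 / (2 * real l + 1)"
  have w: "0 < w" using assms by (simp add: w_def)
  have c: "0 < c" by (simp add: c_def)
  have "w \<le> 1 - u\<^sup>2"
  proof -
    have "\<bar>u\<bar> * \<bar>u\<bar> \<le> \<bar>u\<bar> * 1" using assms(2) by (intro mult_left_mono) auto
    then show ?thesis by (simp add: w_def power2_eq_square)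
  qed
  then have "sqrt w * p\<^sup>2 \<le> sqrt (1 - u\<^sup>2) * p\<^sup>2" by (intro mult_right_mono) auto
  also have "\<dots> \<le> c" using legendre_bernstein[OF assms] by (simp add: p_def c_def)
  finally have *: "sqrt w * p\<^sup>2 \<le> c" .
  show ?thesis
  proof (cases "p = 0")
    case False
    then have p: "0 < p" by (simp add: p_def)
    have "p\<^sup>2 \<le> c * w powr (- 1 / 2)"
      using * w by (simp add: powr_minus powr_half_sqrt divide_simps mult.commute)
    then have "(p\<^sup>2) powr (3 / 2) \<le> (c * w powr (- 1 / 2)) powr (3 / 2)"
      by (intro powr_mono2) auto
    also have "(p\<^sup>2) powr (3 / 2) = p ^ 3"
      using p by (simp add: powr_powr flip: powr_numeral)
    also have "(c * w powr (- 1 / 2)) powr (3 / 2) = c powr (3 / 2) * w powr (- 3 / 4)"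
      using c by (simp add: powr_mult powr_powr)
    finally show ?thesis unfolding p_def w_def c_def .
  qed (simp add: p_def)
qed

lemma has_integral_one_minus_abs_powr:
  "((\<lambda>u. (1 - \<bar>u\<bar>) powr (- 3 / 4)) has_integral 8) {-1..1::real}"
proof -
  have "((\<lambda>u. (1 - \<bar>u\<bar>) powr (- 3 / 4)) has_integral (- 4 * (1 - 1) powr (1 / 4)) - (- 4 * (1 - 0) powr (1 / 4))) {0..1::real}"
  proof (rule fundamental_theorem_of_calculus_interior)
    show "continuous_on {0..1} (\<lambda>u::real. - 4 * (1 - u) powr (1 / 4))"
      by (intro continuous_intros continuous_on_powr') auto
    fix u :: real assume u: "u \<in> {0<..<1}"
    have "((\<lambda>u. - 4 * (1 - u) powr (1 / 4)) has_real_derivative - 4 * (1 / 4 * (1 - u) powr (1 / 4 - 1) * (- 1))) (at u)"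
      using u by (auto intro!: derivative_eq_intros simp: powr_diff)
    then show "((\<lambda>u. - 4 * (1 - u) powr (1 / 4)) has_vector_derivative (1 - \<bar>u\<bar>) powr (- 3 / 4)) (at u)"
      using u by (simp add: has_real_derivative_iff_has_vector_derivative)
  qed simp
  then have right: "((\<lambda>u. (1 - \<bar>u\<bar>) powr (- 3 / 4)) has_integral 4) {0..1::real}" by simp
  then have "((\<lambda>u. (1 - \<bar>u\<bar>) powr (- 3 / 4)) has_integral 4) {-1..0::real}"
    using has_integral_reflect_real[of "\<lambda>u. (1 - \<bar>u\<bar>) powr (- 3 / 4)" 4 1 0] by simp
  from has_integral_combine[OF _ _ this right] show ?thesis by simp
qed

lemma integral_legendre_cube_le:
  assumes "0 < l"
  shows "integral {-1..1} (\<lambda>u. \<bar>poly (legendre l) u\<bar> ^ 3) \<le> 8 * (4 / (2 * real l + 1)) powr (3 / 2)"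
proof -
  let ?c = "(4 / (2 * real l + 1)) powr (3 / 2)"
  have int: "(\<lambda>u. \<bar>poly (legendre l) u\<bar> ^ 3) integrable_on {-1..1}"
    by (intro integrable_continuous_real continuous_intros)
  have "integral {-1..1} (\<lambda>u. \<bar>poly (legendre l) u\<bar> ^ 3) \<le> ?c * 8"
  proof (rule has_integral_le)
    \<comment> \<open>At the ends \<open>0 powr (- 3 / 4)\<close> is 0 while the Legendre polynomial
      has absolute value 1, so the integrand is changed at these two points.\<close>
    show "((\<lambda>u. if u \<in> {-1, 1} then 0 else \<bar>poly (legendre l) u\<bar> ^ 3) has_integral
        integral {-1..1} (\<lambda>u. \<bar>poly (legendre l) u\<bar> ^ 3)) {-1..1}"
      by (rule has_integral_spike_finite[OF _ _ integrable_integral[OF int], of "{-1, 1}"]) auto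
    show "((\<lambda>u. ?c * (1 - \<bar>u\<bar>) powr (- 3 / 4)) has_integral ?c * 8) {-1..1}"
      by (rule has_integral_mult_right[OF has_integral_one_minus_abs_powr])
    fix u :: real assume "u \<in> {-1..1}"
    then show "(if u \<in> {-1, 1} then 0 else \<bar>poly (legendre l) u\<bar> ^ 3) \<le> ?c * (1 - \<bar>u\<bar>) powr (- 3 / 4)"
      using legendre_cube_bound[OF assms, of u] by auto
  qed
  then show ?thesis by simp
qed

section \<open>Archimedes' theorem\<close>

text \<open>Identifies \<open>real^3\<close> with a product of lines, so that Fubini can slice along
  the first coordinate.\<close>

definition cart3 :: "real \<times> real \<times> real \<Rightarrow> real^3" where
  "cart3 p = fst p *\<^sub>R axis 1 1 + fst (snd p) *\<^sub>R axis 2 1 + snd (snd p) *\<^sub>R axis 3 1"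

lemma cart3_nth [simp]:
  "cart3 p $ 1 = fst p" "cart3 p $ 2 = fst (snd p)" "cart3 p $ 3 = snd (snd p)"
  by (simp_all add: cart3_def axis_def)

lemma norm_cart3: "norm (cart3 (s, z)) = sqrt (s\<^sup>2 + (norm z)\<^sup>2)"
  by (cases z) (simp add: norm_vec_def L2_set_def sum_3 norm_Pair)

lemma measurable_cart3 [measurable]: "cart3 \<in> borel_measurable borel"
proof -
  have "cart3 \<in> borel_measurable (borel \<Otimes>\<^sub>M (borel \<Otimes>\<^sub>M borel))"
    unfolding cart3_def[abs_def] by measurable
  then show ?thesis by (simp add: borel_prod)
qed

lemma emeasure_lborel_Times:
  fixes A :: "'a::euclidean_space set" and B :: "'b::euclidean_space set"
  assumes "A \<in> sets borel" "B \<in> sets borel"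
  shows "emeasure lborel (A \<times> B) = emeasure lborel A * emeasure lborel B"
  using assms by (subst lborel_prod[symmetric]) (simp add: lborel.emeasure_pair_measure_Times)

text \<open>Lebesgue measure is determined by the volumes of boxes, and preimages of boxes under
  \<open>cart3\<close> are products of intervals.\<close>

lemma lborel_cart3: "lborel = distr lborel borel cart3"
proof (rule lborel_eqI)
  fix l u :: "real^3"
  assume le: "\<And>b. b \<in> Basis \<Longrightarrow> l \<bullet> b \<le> u \<bullet> b"
  have le': "l $ i \<le> u $ i" for i
    using le[of "axis i 1"] by (simp add: inner_axis axis_in_Basis_iff)
  have "cart3 -` box l u = {l$1<..<u$1} \<times> {l$2<..<u$2} \<times> {l$3<..<u$3}"
    by (auto simp: mem_box_cart forall_3)
  then have "emeasure (distr lborel borel cart3) (box l u)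
      = emeasure lborel ({l$1<..<u$1} \<times> {l$2<..<u$2} \<times> {l$3<..<u$3})"
    by (subst emeasure_distr) simp_all
  also have "\<dots> = ennreal (u$1 - l$1) * (ennreal (u$2 - l$2) * ennreal (u$3 - l$3))"
    using le' by (simp add: emeasure_lborel_Times borel_Times)
  also have "\<dots> = ennreal (\<Prod>i\<in>UNIV. u$i - l$i)"
  proof -
    have "(\<Prod>i\<in>UNIV. u$i - l$i) = (u$1 - l$1) * ((u$2 - l$2) * (u$3 - l$3))"
      unfolding UNIV_3 by simp
    then show ?thesis using le' by (simp only: ennreal_mult diff_ge_0_iff_ge zero_le_mult_iff simp_thms)
  qed
  also have "(\<Prod>i\<in>UNIV. u$i - l$i) = (\<Prod>b\<in>Basis. (u - l) \<bullet> b)"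
  proof -
    have "bij_betw (\<lambda>i. axis i 1) UNIV (Basis :: (real^3) set)"
      by (auto simp: bij_betw_def inj_on_def axis_eq_axis Basis_vec_def)
    from prod.reindex_bij_betw[OF this, of "\<lambda>b. (u - l) \<bullet> b"] show ?thesis
      by (simp add: inner_axis)
  qed
  finally show "emeasure (distr lborel borel cart3) (box l u) = (\<Prod>b\<in>Basis. (u - l) \<bullet> b)" .
qed simp

lemma emeasure_lborel_slices:
  fixes C :: "(real^3) set"
  assumes C: "C \<in> sets borel"
  shows "emeasure lborel C = (\<integral>\<^sup>+s. emeasure lborel {z. cart3 (s, z) \<in> C} \<partial>lborel)"
proof -
  have "emeasure lborel C = emeasure (distr lborel borel cart3) C"
    by (rule arg_cong[where f="\<lambda>M. emeasure M C", OF lborel_cart3])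
  also have "\<dots> = emeasure (lborel \<Otimes>\<^sub>M lborel) (cart3 -` C)"
    using C by (subst emeasure_distr) (simp_all add: lborel_prod)
  also have "\<dots> = (\<integral>\<^sup>+s. emeasure lborel (Pair s -` (cart3 -` C)) \<partial>lborel)"
    using measurable_sets[OF measurable_cart3 C]
    by (intro lborel.emeasure_pair_measure_alt) (simp only: lborel_prod sets_lborel space_borel Int_UNIV_right)
  also have "\<dots> = (\<integral>\<^sup>+s. emeasure lborel {z. cart3 (s, z) \<in> C} \<partial>lborel)"
    by (simp add: vimage_def)
  finally show ?thesis .
qed

lemma emeasure_disc:
  fixes c :: "real \<times> real"
  assumes "0 \<le> r"
  shows "emeasure lborel (cball c r) = ennreal (pi * r\<^sup>2)" "emeasure lborel (ball c r) = ennreal (pi * r\<^sup>2)"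
  using emeasure_cball[OF assms, of c] emeasure_ball[OF assms, of c] by (simp_all add: unit_ball_vol_2 power2_eq_square)

text \<open>The part of the unit ball over the open cap around the first axis at height
  \<open>a\<close>. By construction of \<open>sphere_measure\<close>, the area of the cap is three
  times the volume of this set.\<close>

definition cap_cone :: "real \<Rightarrow> (real^3) set" where
  "cap_cone a = {y. norm y \<le> 1 \<and> y \<noteq> 0 \<and> a * norm y < y $ 1}"

text \<open>Slices are discs. Below height \<open>a\<close> the cone is the active constraint and
  the disc is open; above \<open>a\<close> it is the ball and the disc is closed. The heights 0 and
  \<open>a\<close> are left out: they form a null set, and at \<open>a\<close> both indicators would
  count.\<close>

lemma cap_cone_slice:
  fixes s :: real
  assumes a: "0 \<le> a" "a < 1" and s: "s \<noteq> 0" "s \<noteq> a"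
  shows "emeasure lborel {z. cart3 (s, z) \<in> cap_cone a}
    = ennreal (pi * (1 - a\<^sup>2) / a\<^sup>2 * s\<^sup>2) * indicator {0..a} s + ennreal (pi * (1 - s\<^sup>2)) * indicator {a..1} s"
proof -
  have mem: "cart3 (s, z) \<in> cap_cone a \<longleftrightarrow> s\<^sup>2 + (norm z)\<^sup>2 \<le> 1 \<and> a * sqrt (s\<^sup>2 + (norm z)\<^sup>2) < s" for z
  proof -
    have "cart3 (s, z) \<noteq> 0"
      using s(1) by (auto dest: arg_cong[where f="\<lambda>y. y $ 1"])
    then show ?thesis by (simp add: cap_cone_def norm_cart3)
  qed
  consider "s < 0" | "0 < s" "s < a" | "a < s" "s \<le> 1" | "1 < s" using s by linarith
  then show ?thesis
  proof cases
    case 1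
    then have "a * sqrt (s\<^sup>2 + (norm z)\<^sup>2) \<ge> s" for z :: "real \<times> real"
      using a by (smt (verit) mult_nonneg_nonneg real_sqrt_ge_zero zero_le_power2)
    then have "{z. cart3 (s, z) \<in> cap_cone a} = {}" by (auto simp: mem not_less)
    then have "emeasure lborel {z. cart3 (s, z) \<in> cap_cone a} = 0" by (simp only: emeasure_empty)
    with 1 a show ?thesis by simp
  next
    case 2
    define r where "r = s * sqrt (1 - a\<^sup>2) / a"
    have a2: "a\<^sup>2 < 1" using a by (simp add: abs_square_less_1)
    have r: "0 \<le> r" "r\<^sup>2 = s\<^sup>2 * (1 - a\<^sup>2) / a\<^sup>2" using 2 a a2 by (simp_all add: r_def power_mult_distrib power_divide)
    have "cart3 (s, z) \<in> cap_cone a \<longleftrightarrow> norm z < r" for z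
    proof -
      have square: "x < y \<longleftrightarrow> x\<^sup>2 < y\<^sup>2" if "0 \<le> x" "0 \<le> y" for x y :: real
        using that by (metis power2_less_imp_less power_strict_mono pos2)
      have "a * sqrt (s\<^sup>2 + (norm z)\<^sup>2) < s \<longleftrightarrow> (a * sqrt (s\<^sup>2 + (norm z)\<^sup>2))\<^sup>2 < s\<^sup>2"
        using 2 a by (intro square) auto
      also have "\<dots> \<longleftrightarrow> a\<^sup>2 * (norm z)\<^sup>2 < s\<^sup>2 * (1 - a\<^sup>2)"
        by (simp add: power_mult_distrib algebra_simps)
      also have "\<dots> \<longleftrightarrow> (norm z)\<^sup>2 < r\<^sup>2"
        unfolding r(2) using 2 by (simp add: field_simps)
      also have "\<dots> \<longleftrightarrow> norm z < r"
        using r(1) by (intro square[symmetric]) auto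
      finally have iff: "a * sqrt (s\<^sup>2 + (norm z)\<^sup>2) < s \<longleftrightarrow> norm z < r" .
      have "s\<^sup>2 + (norm z)\<^sup>2 \<le> 1" if "a * sqrt (s\<^sup>2 + (norm z)\<^sup>2) < s"
      proof -
        have "a * sqrt (s\<^sup>2 + (norm z)\<^sup>2) < a * 1" using that 2 by linarith
        then have "sqrt (s\<^sup>2 + (norm z)\<^sup>2) < 1" by (rule mult_left_less_imp_less) (use a in simp)
        then show ?thesis by simp
      qed
      with iff show ?thesis by (auto simp: mem)
    qed
    then have "{z. cart3 (s, z) \<in> cap_cone a} = ball 0 r"
      by (intro set_eqI) (simp only: mem_Collect_eq mem_ball_0)
    with 2 r show ?thesis by (simp add: emeasure_disc mult_ac)
  next
    case 3
    have s2: "s\<^sup>2 \<le> 1" using 3 a by (simp add: abs_square_le_1)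
    have "cart3 (s, z) \<in> cap_cone a \<longleftrightarrow> norm z \<le> sqrt (1 - s\<^sup>2)" for z
    proof -
      have "a * sqrt (s\<^sup>2 + (norm z)\<^sup>2) < s" if "s\<^sup>2 + (norm z)\<^sup>2 \<le> 1"
      proof -
        have "a * sqrt (s\<^sup>2 + (norm z)\<^sup>2) \<le> a * 1" using that a by (intro mult_left_mono) auto
        with 3 show ?thesis by simp
      qed
      moreover have "s\<^sup>2 + (norm z)\<^sup>2 \<le> 1 \<longleftrightarrow> norm z \<le> sqrt (1 - s\<^sup>2)"
        using real_sqrt_le_iff[of "(norm z)\<^sup>2" "1 - s\<^sup>2"] by (simp add: algebra_simps)
      ultimately show ?thesis by (auto simp: mem)
    qed
    then have "{z. cart3 (s, z) \<in> cap_cone a} = cball 0 (sqrt (1 - s\<^sup>2))"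
      by (intro set_eqI) (simp only: mem_Collect_eq mem_cball_0)
    with 3 a s2 show ?thesis by (simp add: emeasure_disc)
  next
    case 4
    then have "1 < s\<^sup>2" by (simp add: one_less_power)
    then have "{z. cart3 (s, z) \<in> cap_cone a} = {}" by (auto simp: mem) (smt (verit) zero_le_power2)
    then have "emeasure lborel {z. cart3 (s, z) \<in> cap_cone a} = 0" by (simp only: emeasure_empty)
    with 4 a show ?thesis by simp
  qed
qed

lemma cap_cone_borel: "cap_cone a \<in> sets borel"
proof -
  have [measurable]: "(\<lambda>y :: real^3. y $ 1) \<in> borel_measurable borel"
    by (intro borel_measurable_continuous_onI continuous_intros)
  show ?thesis unfolding cap_cone_def by measurable
qed

lemma emeasure_cap_cone:
  assumes a: "0 \<le> a" "a < 1"
  shows "emeasure lborel (cap_cone a) = ennreal (2 / 3 * pi * (1 - a))"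
proof -
  have "emeasure lborel (cap_cone a) = (\<integral>\<^sup>+s. ennreal (pi * (1 - a\<^sup>2) / a\<^sup>2 * s\<^sup>2) * indicator {0..a} s
      + ennreal (pi * (1 - s\<^sup>2)) * indicator {a..1} s \<partial>lborel)"
    unfolding emeasure_lborel_slices[OF cap_cone_borel]
  proof (rule nn_integral_cong_AE)
    show "AE s in lborel. emeasure lborel {z. cart3 (s, z) \<in> cap_cone a}
        = ennreal (pi * (1 - a\<^sup>2) / a\<^sup>2 * s\<^sup>2) * indicator {0..a} s + ennreal (pi * (1 - s\<^sup>2)) * indicator {a..1} s"
      using AE_lborel_singleton[of 0] AE_lborel_singleton[of a]
      by eventually_elim (rule cap_cone_slice[OF a])
  qed
  also have "\<dots> = (\<integral>\<^sup>+s. ennreal (pi * (1 - a\<^sup>2) / a\<^sup>2 * s\<^sup>2) * indicator {0..a} s \<partial>lborel)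
      + (\<integral>\<^sup>+s. ennreal (pi * (1 - s\<^sup>2)) * indicator {a..1} s \<partial>lborel)"
    by (rule nn_integral_add) measurable
  also have "(\<integral>\<^sup>+s. ennreal (pi * (1 - a\<^sup>2) / a\<^sup>2 * s\<^sup>2) * indicator {0..a} s \<partial>lborel)
      = ennreal (pi * (1 - a\<^sup>2) / a\<^sup>2 * a ^ 3 / 3 - pi * (1 - a\<^sup>2) / a\<^sup>2 * 0 ^ 3 / 3)"
  proof (rule nn_integral_FTC_Icc)
    fix s :: real assume "s \<in> {0..a}"
    have "((\<lambda>s. c * s ^ 3 / 3) has_real_derivative c * s\<^sup>2) (at s)" for c
      by (auto intro!: derivative_eq_intros)
    then show "((\<lambda>s. pi * (1 - a\<^sup>2) / a\<^sup>2 * s ^ 3 / 3) has_real_derivative pi * (1 - a\<^sup>2) / a\<^sup>2 * s\<^sup>2) (at s)" .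
    show "0 \<le> pi * (1 - a\<^sup>2) / a\<^sup>2 * s\<^sup>2" using a by (simp add: abs_square_le_1)
  qed (use a in auto)
  also have "(\<integral>\<^sup>+s. ennreal (pi * (1 - s\<^sup>2)) * indicator {a..1} s \<partial>lborel)
      = ennreal (pi * (1 - 1 ^ 3 / 3) - pi * (a - a ^ 3 / 3))"
  proof (rule nn_integral_FTC_Icc)
    fix s :: real assume s: "s \<in> {a..1}"
    show "((\<lambda>s. pi * (s - s ^ 3 / 3)) has_real_derivative pi * (1 - s\<^sup>2)) (at s)"
      by (auto intro!: derivative_eq_intros)
    show "0 \<le> pi * (1 - s\<^sup>2)" using a s by (simp add: abs_square_le_1)
  qed (use a in auto)
  also have "ennreal (pi * (1 - a\<^sup>2) / a\<^sup>2 * a ^ 3 / 3 - pi * (1 - a\<^sup>2) / a\<^sup>2 * 0 ^ 3 / 3)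
      + ennreal (pi * (1 - 1 ^ 3 / 3) - pi * (a - a ^ 3 / 3)) = ennreal (2 / 3 * pi * (1 - a))"
  proof -
    \<comment> \<open>The cancellation includes \<open>a = 0\<close>, where division by zero gives 0
      on the left and the factor \<open>a\<close> gives 0 on the right.\<close>
    have e1: "pi * (1 - a\<^sup>2) / a\<^sup>2 * a ^ 3 / 3 - pi * (1 - a\<^sup>2) / a\<^sup>2 * 0 ^ 3 / 3 = pi * (1 - a\<^sup>2) * a / 3"
      by (simp add: power2_eq_square power3_eq_cube)
    have e2: "pi * (1 - 1 ^ 3 / 3) - pi * (a - a ^ 3 / 3) = pi / 3 * ((1 - a)\<^sup>2 * (2 + a))"
      by (simp add: power2_eq_square power3_eq_cube field_simps)
    \<comment> \<open>The cubic parts of the cone and of the ball segment cancel, which leaves a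
      volume affine in the height.\<close>
    have sum: "2 / 3 * pi * (1 - a) = pi * (1 - a\<^sup>2) * a / 3 + pi / 3 * ((1 - a)\<^sup>2 * (2 + a))"
      by (simp add: power2_eq_square field_simps)
    show ?thesis
      unfolding e1 e2 sum by (rule ennreal_plus[symmetric]) (use a in \<open>simp_all add: abs_square_le_1\<close>)
  qed
  finally show ?thesis .
qed

section \<open>From cap areas to zonal integrals\<close>

lemma borel_measurable_inner_sphere:
  fixes x :: "real^3"
  shows "(\<lambda>\<xi>. x \<bullet> \<xi>) \<in> borel_measurable sphere_measure"
proof -
  have "(\<lambda>\<xi>. x \<bullet> \<xi>) \<in> borel_measurable (restrict_space borel (sphere 0 1))"
    by (intro measurable_restrict_space1) measurable
  then show ?thesis using measurable_cong_sets[OF sets_sphere_measure refl] by blast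
qed

lemma sets_inner_sphere:
  fixes x :: "real^3"
  assumes "B \<in> sets borel"
  shows "{\<xi> \<in> sphere 0 1. x \<bullet> \<xi> \<in> B} \<in> sets sphere_measure"
proof -
  have "{\<xi> \<in> sphere 0 1. x \<bullet> \<xi> \<in> B} = (\<lambda>\<xi>. x \<bullet> \<xi>) -` B \<inter> space sphere_measure"
    by (auto simp: space_sphere_measure)
  also have "\<dots> \<in> sets sphere_measure" by (rule measurable_sets[OF borel_measurable_inner_sphere assms])
  finally show ?thesis .
qed

lemma finite_sphere_measure: "finite_measure sphere_measure"
  by (rule finite_measureI) (simp add: space_sphere_measure emeasure_sphere_measure_space)

text \<open>An orthogonal map carries the first axis to \<open>x\<close> and preserves the surface
  measure, so the volume of \<open>cap_cone\<close> settles every direction.\<close>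

lemma measure_cap:
  fixes x :: "real^3"
  assumes x: "norm x = 1" and a: "0 \<le> a" "a < 1"
  shows "measure sphere_measure {\<xi> \<in> sphere 0 1. a < x \<bullet> \<xi>} = 2 * pi * (1 - a)"
proof -
  have "norm (axis 1 1 :: real^3) = norm x" using x by simp
  then obtain f :: "real^3 \<Rightarrow> real^3" where f: "orthogonal_transformation f" "f (axis 1 1) = x"
    by (rule orthogonal_transformation_exists)
  define A where "A = {\<xi> \<in> sphere 0 1. a < (axis 1 1 :: real^3) \<bullet> \<xi>}"
  have sets: "{\<xi> \<in> sphere 0 1. a < y \<bullet> \<xi>} \<in> sets sphere_measure" for y :: "real^3"
    using sets_inner_sphere[of "{a<..}" y] by simp
  have fA: "f ` A = {\<xi> \<in> sphere 0 1. a < x \<bullet> \<xi>}"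
  proof (intro subset_antisym subsetI)
    fix \<xi> assume "\<xi> \<in> f ` A"
    then show "\<xi> \<in> {\<xi> \<in> sphere 0 1. a < x \<bullet> \<xi>}"
      using f(1) unfolding f(2)[symmetric]
      by (auto simp: A_def orthogonal_transformation_norm) (simp add: orthogonal_transformation_def)
  next
    fix \<xi> assume \<xi>: "\<xi> \<in> {\<xi> \<in> sphere 0 1. a < x \<bullet> \<xi>}"
    obtain \<eta> where \<eta>: "\<xi> = f \<eta>" using orthogonal_transformation_surj[OF f(1)] by (rule surjE)
    have "\<eta> \<in> A"
      using \<xi> f(1) unfolding \<eta> f(2)[symmetric]
      by (auto simp: A_def orthogonal_transformation_norm) (simp add: orthogonal_transformation_def)
    then show "\<xi> \<in> f ` A" unfolding \<eta> by (rule imageI)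
  qed
  have "emeasure sphere_measure (f ` A) = emeasure sphere_measure A"
    by (rule emeasure_sphere_measure_orthogonal[OF f(1)]) (unfold fA, unfold A_def, rule sets, rule sets)
  also have "\<dots> = 3 * emeasure lborel {y \<in> cball 0 1 - {0}. sgn y \<in> A}"
    by (rule emeasure_sphere_measure) (unfold A_def, rule sets)
  also have "{y \<in> cball 0 1 - {0}. sgn y \<in> A} = cap_cone a"
    by (auto simp: A_def cap_cone_def norm_sgn sgn_div_norm inner_axis' divide_simps mult.commute)
  also have "3 * emeasure lborel (cap_cone a) = ennreal (3 * (2 / 3 * pi * (1 - a)))"
    using a unfolding emeasure_cap_cone[OF a] by (subst ennreal_mult) auto
  finally show ?thesis unfolding fA using a by (simp add: measure_def)
qed

text \<open>For \<open>0 \<le> a < 1\<close> this is the complement of a known cap. For negative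
  \<open>a\<close> the cap around \<open>- x\<close> is known, but as an open cap; monotonicity and
  a limit from the right reach the closed one without computing the measure of a circle.\<close>

lemma measure_lower_cap:
  fixes x :: "real^3"
  assumes x: "norm x = 1" and a: "- 1 \<le> a" "a \<le> 1"
  shows "measure sphere_measure {\<xi> \<in> sphere 0 1. x \<bullet> \<xi> \<le> a} = 2 * pi * (1 + a)"
proof -
  interpret finite_measure sphere_measure by (rule finite_sphere_measure)
  have total: "measure sphere_measure (sphere 0 1) = 4 * pi"
    by (simp add: measure_def emeasure_sphere_measure_space)
  have sets: "{\<xi> \<in> sphere 0 1. y \<bullet> \<xi> \<le> b} \<in> sets sphere_measure"
    "{\<xi> \<in> sphere 0 1. b < y \<bullet> \<xi>} \<in> sets sphere_measure"
    "{\<xi> \<in> sphere 0 1. y \<bullet> \<xi> < b} \<in> sets sphere_measure" for y :: "real^3" and b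
    using sets_inner_sphere[of "{..b}" y] sets_inner_sphere[of "{b<..}" y] sets_inner_sphere[of "{..<b}" y] by simp_all
  consider "a = 1" | "0 \<le> a" "a < 1" | "a < 0" using a by linarith
  then show ?thesis
  proof cases
    case 1
    have "x \<bullet> \<xi> \<le> 1" if "norm \<xi> = 1" for \<xi>
      using norm_cauchy_schwarz[of x \<xi>] x that by simp
    then have "{\<xi> \<in> sphere 0 1. x \<bullet> \<xi> \<le> a} = sphere 0 1" by (auto simp: 1)
    with total 1 show ?thesis by simp
  next
    case 2
    have "{\<xi> \<in> sphere 0 1. x \<bullet> \<xi> \<le> a} = space sphere_measure - {\<xi> \<in> sphere 0 1. a < x \<bullet> \<xi>}"
      by (auto simp: space_sphere_measure)
    then show ?thesis
      using finite_measure_compl[OF sets(2)[of a x]] measure_cap[OF x 2] total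
      by (simp add: space_sphere_measure algebra_simps)
  next
    case 3
    have open_cap: "measure sphere_measure {\<xi> \<in> sphere 0 1. x \<bullet> \<xi> < b} = 2 * pi * (1 + b)"
      if "- 1 < b" "b \<le> 0" for b
    proof -
      have "norm (- x) = 1" "0 \<le> - b" "- b < 1" using x that by auto
      from measure_cap[OF this] show ?thesis by simp
    qed
    show ?thesis
    proof (rule antisym)
      show "measure sphere_measure {\<xi> \<in> sphere 0 1. x \<bullet> \<xi> \<le> a} \<le> 2 * pi * (1 + a)"
      proof (rule tendsto_lowerbound)
        show "((\<lambda>b. 2 * pi * (1 + b)) \<longlongrightarrow> 2 * pi * (1 + a)) (at_right a)"
          by (intro tendsto_intros)
        show "\<forall>\<^sub>F b in at_right a. measure sphere_measure {\<xi> \<in> sphere 0 1. x \<bullet> \<xi> \<le> a} \<le> 2 * pi * (1 + b)"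
          unfolding eventually_at_right_field
        proof (intro exI[of _ 0] conjI allI impI 3)
          fix b assume b: "a < b" "b < 0"
          have "measure sphere_measure {\<xi> \<in> sphere 0 1. x \<bullet> \<xi> \<le> a}
              \<le> measure sphere_measure {\<xi> \<in> sphere 0 1. x \<bullet> \<xi> < b}"
            using b by (intro finite_measure_mono sets) auto
          with open_cap[of b] a b show "measure sphere_measure {\<xi> \<in> sphere 0 1. x \<bullet> \<xi> \<le> a} \<le> 2 * pi * (1 + b)"
            by simp
        qed
      qed simp
      show "2 * pi * (1 + a) \<le> measure sphere_measure {\<xi> \<in> sphere 0 1. x \<bullet> \<xi> \<le> a}"
      \<comment> \<open>At \<open>a = - 1\<close> the claimed lower bound is 0, and no open cap
        below is needed.\<close>
      proof (cases "a = - 1")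
        case False
        then have "2 * pi * (1 + a) = measure sphere_measure {\<xi> \<in> sphere 0 1. x \<bullet> \<xi> < a}"
          using open_cap[of a] a 3 by simp
        also have "\<dots> \<le> measure sphere_measure {\<xi> \<in> sphere 0 1. x \<bullet> \<xi> \<le> a}"
          by (intro finite_measure_mono sets) auto
        finally show ?thesis .
      qed simp
    qed
  qed
qed

text \<open>Archimedes: the area of a cap is affine in its height, so the projection to an axis is
  uniform on \<open>{-1..1}\<close> with density \<open>2 * pi\<close>. Both measures are finite,
  and equal distribution functions identify them.\<close>

lemma distr_sphere_measure_inner:
  fixes x :: "real^3"
  assumes x: "norm x = 1"
  shows "distr sphere_measure borel (\<lambda>\<xi>. x \<bullet> \<xi>) = density lborel (\<lambda>u. ennreal (2 * pi) * indicator {-1..1} u)"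
    (is "?L = ?R")
proof (rule cdf_unique')
  interpret finite_measure sphere_measure by (rule finite_sphere_measure)
  have R: "emeasure ?R A = ennreal (2 * pi) * emeasure lborel ({-1..1} \<inter> A)" if "A \<in> sets borel" for A
  proof -
    have "emeasure ?R A = (\<integral>\<^sup>+u. ennreal (2 * pi) * indicator {-1..1} u * indicator A u \<partial>lborel)"
      using that by (intro emeasure_density) auto
    also have "\<dots> = (\<integral>\<^sup>+u. ennreal (2 * pi) * indicator ({-1..1} \<inter> A) u \<partial>lborel)"
      by (intro nn_integral_cong) (auto simp: indicator_def)
    also have "\<dots> = ennreal (2 * pi) * emeasure lborel ({-1..1} \<inter> A)"
      using that by (intro nn_integral_cmult_indicator) auto
    finally show ?thesis .
  qed
  have "finite_measure ?R"
    by (rule finite_measureI) (use R[of UNIV] in \<open>simp add: ennreal_mult_eq_top_iff\<close>)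
  then show "finite_borel_measure ?R"
    by (intro finite_borel_measure.intro finite_borel_measure_axioms.intro) auto
  show "finite_borel_measure ?L"
    by (intro finite_borel_measure.intro finite_borel_measure_axioms.intro finite_measure_distr borel_measurable_inner_sphere) auto
  show "cdf ?L = cdf ?R"
  proof
    fix a
    have L: "cdf ?L a = measure sphere_measure {\<xi> \<in> sphere 0 1. x \<bullet> \<xi> \<le> a}"
      unfolding cdf_def using borel_measurable_inner_sphere[of x]
      by (subst measure_distr) (auto intro!: arg_cong[where f="measure sphere_measure"] simp: space_sphere_measure)
    have R': "cdf ?R a = 2 * pi * measure lborel ({-1..1} \<inter> {..a})"
      by (simp add: cdf_def measure_def R enn2real_mult)
    have bd: "- 1 \<le> x \<bullet> \<xi>" "x \<bullet> \<xi> \<le> 1" if "norm \<xi> = 1" for \<xi>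
      using Cauchy_Schwarz_ineq2[of x \<xi>] x that by (auto simp: abs_le_iff)
    consider "a < - 1" | "- 1 \<le> a" "a \<le> 1" | "1 < a" by linarith
    then show "cdf ?L a = cdf ?R a"
    proof cases
      case 1
      then have "{\<xi> \<in> sphere 0 1. x \<bullet> \<xi> \<le> a} = {}" "{-1..1} \<inter> {..a} = {}" using bd by fastforce+
      then show ?thesis unfolding L R' by (simp only: measure_empty mult_zero_right)
    next
      case 2
      then have i: "{-1..1} \<inter> {..a} = {-1..a}" by auto
      show ?thesis unfolding L R' i measure_lower_cap[OF x 2] using 2 by simp
    next
      case 3
      then have "{\<xi> \<in> sphere 0 1. x \<bullet> \<xi> \<le> a} = {\<xi> \<in> sphere 0 1. x \<bullet> \<xi> \<le> 1}" "{-1..1} \<inter> {..a} = {-1..1}"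
        using bd by fastforce+
      then show ?thesis unfolding L R' by (simp only: measure_lower_cap[OF x]) simp
    qed
  qed
qed

lemma integral_sphere_zonal:
  fixes x :: "real^3" and F :: "real \<Rightarrow> real"
  assumes x: "norm x = 1" and F: "continuous_on UNIV F"
  shows "(\<integral>\<xi>. F (x \<bullet> \<xi>) \<partial>sphere_measure) = 2 * pi * integral {-1..1} F"
proof -
  have [measurable]: "F \<in> borel_measurable borel" using F by (rule borel_measurable_continuous_onI)
  have "(\<integral>\<xi>. F (x \<bullet> \<xi>) \<partial>sphere_measure) = (\<integral>u. F u \<partial>distr sphere_measure borel (\<lambda>\<xi>. x \<bullet> \<xi>))"
    using borel_measurable_inner_sphere by (subst integral_distr) auto
  also have "\<dots> = (\<integral>u. F u \<partial>density lborel (\<lambda>u. ennreal (2 * pi * indicator {-1..1} u)))"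
    unfolding distr_sphere_measure_inner[OF x] by (simp add: ennreal_mult' ennreal_indicator)
  also have "\<dots> = (\<integral>u. (2 * pi * indicator {-1..1} u) *\<^sub>R F u \<partial>lborel)"
    by (rule integral_density) auto
  also have "\<dots> = 2 * pi * (\<integral>u\<in>{-1..1}. F u \<partial>lborel)"
    by (simp add: set_lebesgue_integral_def mult.assoc)
  also have "(\<integral>u\<in>{-1..1}. F u \<partial>lborel) = integral {-1..1} F"
    by (intro set_borel_integral_eq_integral(2) borel_integrable_atLeastAtMost')
       (auto intro: continuous_on_subset[OF F])
  finally show ?thesis .
qed

section \<open>The Poisson wave\<close>

lemma integral_scale_measure:
  fixes f :: "'a \<Rightarrow> real"
  assumes "0 \<le> c" "f \<in> borel_measurable M"
  shows "(\<integral>x. f x \<partial>scale_measure (ennreal c) M) = c * (\<integral>x. f x \<partial>M)"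
proof -
  have "scale_measure (ennreal c) M = density M (\<lambda>_. ennreal c)"
    by (rule measure_eqI) (simp_all add: emeasure_density_const)
  then show ?thesis
    using integral_density[of f M "\<lambda>_. c"] assms by simp
qed

text \<open>The wave is the integral of \<open>f = c * P_l (x \<bullet> \<xi>)\<close>, and
  \<open>c\<close> is exactly the factor that gives unit variance under the intensity. The third
  moment is at most \<open>16 / sqrt v\<close>, and the general bound multiplies it by 6.\<close>

lemma poisson_wave_lipschitz_bound:
  fixes M :: "'a measure" and h :: "real \<Rightarrow> real"
  assumes prm: "poisson_random_measure M N (scale_measure (ennreal v) sphere_measure)"
    and v: "0 < v" and l: "0 < l" and x: "norm x = 1" and h: "1-lipschitz_on UNIV h"
  shows "\<bar>(\<integral>\<omega>. h (poisson_wave v N l x \<omega>) \<partial>M) - (\<integral>z. std_normal_density z * h z \<partial>lborel)\<bar> \<le> 96 / sqrt v"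
proof -
  let ?L = "scale_measure (ennreal v) sphere_measure"
  define k where "k = (2 * real l + 1) / (4 * pi)"
  define c where "c = 1 / sqrt v * sqrt k"
  define p where "p = poly (legendre l)"
  define f where "f \<xi> = c * p (x \<bullet> \<xi>)" for \<xi>
  have k: "0 < k" by (simp add: k_def)
  have c: "0 < c" using v k by (simp add: c_def)
  have cont: "continuous_on UNIV p" unfolding p_def by (intro continuous_intros)
  have meas: "(\<lambda>\<xi>. F (x \<bullet> \<xi>)) \<in> borel_measurable sphere_measure" if "continuous_on UNIV F" for F :: "real \<Rightarrow> real"
    using borel_measurable_inner_sphere borel_measurable_continuous_onI[OF that] by (rule measurable_compose)
  have zonal: "(\<integral>\<xi>. F (x \<bullet> \<xi>) \<partial>?L) = v * (2 * pi * integral {-1..1} F)"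
    if "continuous_on UNIV F" for F :: "real \<Rightarrow> real"
    using integral_scale_measure[OF _ meas[OF that], of v] integral_sphere_zonal[OF x that] v by simp
  have wave: "poisson_wave v N l x \<omega> = (\<integral>\<xi>. f \<xi> \<partial>N \<omega>)" for \<omega>
    by (simp add: poisson_wave_def f_def c_def k_def p_def)
  have fin: "finite_measure ?L"
    by (rule finite_measureI)
       (simp add: space_scale_measure space_sphere_measure emeasure_sphere_measure_space ennreal_mult_eq_top_iff)
  have f_meas: "f \<in> borel_measurable ?L"
    unfolding f_def using meas[of "\<lambda>u. c * p u"] cont
    by (simp add: measurable_cong_sets[OF sets_scale_measure refl] continuous_on_mult_left)
  have "bounded (p ` {-1..1})"
    by (intro compact_imp_bounded compact_continuous_image continuous_on_subset[OF cont]) auto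
  then obtain B where B: "\<forall>u\<in>{-1..1}. \<bar>p u\<bar> \<le> B"
    by (auto simp: bounded_iff)
  have f_bound: "\<bar>f \<xi>\<bar> \<le> c * B" if "\<xi> \<in> space ?L" for \<xi>
  proof -
    have "norm \<xi> = 1" using that by (simp add: space_scale_measure space_sphere_measure)
    then have "x \<bullet> \<xi> \<in> {-1..1}"
      using Cauchy_Schwarz_ineq2[of x \<xi>] x by (auto simp: abs_le_iff)
    from bspec[OF B this] show ?thesis using c by (simp add: f_def abs_mult)
  qed
  have "(\<integral>\<xi>. f \<xi> \<partial>?L) = c * (\<integral>\<xi>. p (x \<bullet> \<xi>) \<partial>?L)" by (simp add: f_def)
  also have "\<dots> = 0"
    using integral_unique[OF integral_legendre_eq_0[OF l]] unfolding zonal[OF cont] unfolding p_def by simp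
  finally have f1: "(\<integral>\<xi>. f \<xi> \<partial>?L) = 0" .
  have "(\<integral>\<xi>. (f \<xi>)\<^sup>2 \<partial>?L) = c\<^sup>2 * (\<integral>\<xi>. (p (x \<bullet> \<xi>))\<^sup>2 \<partial>?L)"
    by (simp add: f_def power_mult_distrib)
  also have "(\<integral>\<xi>. (p (x \<bullet> \<xi>))\<^sup>2 \<partial>?L) = v * (2 * pi * (2 / (2 * real l + 1)))"
    using integral_unique[OF integral_legendre_square[of l]]
    by (subst zonal) (auto intro!: continuous_intros cont simp: p_def)
  also have "c\<^sup>2 * (v * (2 * pi * (2 / (2 * real l + 1)))) = 1"
  proof -
    have "c\<^sup>2 = k / v" using v k by (simp add: c_def power_mult_distrib power_divide)
    then show ?thesis using v by (simp add: k_def add_nonneg_eq_0_iff)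
  qed
  finally have f2: "(\<integral>\<xi>. (f \<xi>)\<^sup>2 \<partial>?L) = 1" .
  have "(\<integral>\<xi>. \<bar>f \<xi>\<bar> ^ 3 \<partial>?L) = c ^ 3 * (\<integral>\<xi>. \<bar>p (x \<bullet> \<xi>)\<bar> ^ 3 \<partial>?L)"
    using c by (simp add: f_def abs_mult power_mult_distrib)
  also have "(\<integral>\<xi>. \<bar>p (x \<bullet> \<xi>)\<bar> ^ 3 \<partial>?L) = v * (2 * pi * integral {-1..1} (\<lambda>u. \<bar>p u\<bar> ^ 3))"
    by (subst zonal) (auto intro!: continuous_intros cont)
  also have "c ^ 3 * (v * (2 * pi * integral {-1..1} (\<lambda>u. \<bar>p u\<bar> ^ 3)))
      \<le> c ^ 3 * (v * (2 * pi * (8 * (4 / (2 * real l + 1)) powr (3 / 2))))"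
    using integral_legendre_cube_le[OF l] c v
    by (intro mult_left_mono) (auto simp: p_def)
  also have "\<dots> = 16 / (sqrt v * sqrt pi)"
  proof -
    \<comment> \<open>Here the degree drops out: \<open>c ^ 3\<close> contains \<open>k\<close> to
      the power 3/2, and the bound on the cubic integral contains \<open>pi * k\<close> to the power
      -3/2. The 16 is 2 times the 8 from the integral of
      \<open>(1 - |u|) powr (- 3 / 4)\<close>.\<close>
    have four: "4 / (2 * real l + 1) = 1 / (pi * k)" by (simp add: k_def)
    have pow: "y powr (3 / 2) = sqrt y ^ 3" if "0 < y" for y :: real
    proof -
      have "sqrt y ^ 3 = (y powr (1 / 2)) powr 3" using that by (simp add: powr_half_sqrt powr_numeral)
      then show ?thesis by (simp add: powr_powr)
    qed
    have "c ^ 3 * (v * (2 * pi * (8 * (1 / (pi * k)) powr (3 / 2))))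
        = 16 * (c ^ 3 * v * pi / (sqrt pi ^ 3 * sqrt k ^ 3))"
      using k by (subst pow) (simp_all add: real_sqrt_divide real_sqrt_mult power_divide power_mult_distrib)
    also have "\<dots> = 16 * (v * pi / (sqrt v * sqrt v * sqrt v * (sqrt pi * sqrt pi * sqrt pi)))"
      using k by (simp add: c_def power_divide power3_eq_cube)
    also have "\<dots> = 16 / (sqrt v * sqrt pi)"
      using v by simp
    finally show ?thesis unfolding four .
  qed
  also have "\<dots> \<le> 16 / sqrt v"
  proof -
    have "1 \<le> sqrt pi" using pi_ge_two by simp
    then have "sqrt v * 1 \<le> sqrt v * sqrt pi" using v by (intro mult_left_mono) auto
    then show ?thesis using v by (intro divide_left_mono) auto
  qed
  finally have f3: "(\<integral>\<xi>. \<bar>f \<xi>\<bar> ^ 3 \<partial>?L) \<le> 16 / sqrt v" .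
  from prm_integral_normal_bound[OF prm fin f_meas f_bound f1 f2 h] f3
  show ?thesis unfolding wave by simp
qed

theorem theorem2p1:
  fixes \<nu> :: "real \<Rightarrow> real"
    and M :: "'a measure" and N :: "real \<Rightarrow> 'a \<Rightarrow> (real^3) measure"
    and M' :: "'b measure" and Z :: "'b \<Rightarrow> real"
  assumes "\<And>t. t > 0 \<Longrightarrow> \<nu> t > 0"
    and "filterlim \<nu> at_top at_top"
    and "prob_space M"
    and "\<And>t. t > 0 \<Longrightarrow>
           poisson_random_measure M (N t) (scale_measure (ennreal (\<nu> t)) sphere_measure)"
    and "prob_space M'"
    and "distributed M' lborel Z std_normal_density"
  shows "\<exists>R :: nat \<times> real \<Rightarrow> real.
           R \<in> o[at_top \<times>\<^sub>F at_top](\<lambda>(l, t). sqrt (ln (real l) / \<nu> t)) \<and>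
           (\<forall>\<^sub>F (l, t) in at_top \<times>\<^sub>F at_top. \<forall>x \<in> sphere 0 1.
              wasserstein_dist M (poisson_wave (\<nu> t) (N t) l x) M' Z
                \<le> ereal ((sqrt 3 / (2 * pi\<^sup>2) + 2 / 3 * sqrt (3 / (2 * pi ^ 3)))
                           * sqrt (ln (real l) / \<nu> t) + R (l, t)))"
proof (intro exI conjI)
  let ?R = "\<lambda>(l, t). 96 / sqrt (\<nu> t) :: real"
  show "?R \<in> o[at_top \<times>\<^sub>F at_top](\<lambda>(l :: nat, t). sqrt (ln (real l) / \<nu> t))"
  proof (rule landau_o.smallI)
    fix c :: real assume c: "0 < c"
    \<comment> \<open>The divergence of \<open>ln l\<close> makes the remainder negligible: its
      quotient by \<open>sqrt (ln l / \<nu> t)\<close> is \<open>96 / sqrt (ln l)\<close>.\<close>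
    have "\<forall>\<^sub>F l :: nat in at_top. 96 / c \<le> sqrt (ln (real l))"
    proof -
      have "filterlim (\<lambda>l :: nat. sqrt (ln (real l))) at_top at_top" by real_asymp
      then show ?thesis by (simp add: filterlim_at_top)
    qed
    from eventually_prodI[OF this eventually_gt_at_top[of "0 :: real"]]
    show "\<forall>\<^sub>F p in at_top \<times>\<^sub>F at_top. norm (case p of (l, t) \<Rightarrow> 96 / sqrt (\<nu> t))
        \<le> c * norm (case p of (l, t) \<Rightarrow> sqrt (ln (real l) / \<nu> t))"
    proof (rule eventually_mono)
      fix p :: "nat \<times> real"
      assume "96 / c \<le> sqrt (ln (real (fst p))) \<and> 0 < snd p"
      then obtain l t where p: "p = (l, t)" and l: "96 / c \<le> sqrt (ln (real l))" and t: "0 < t"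
        by (cases p) auto
      have v: "0 < \<nu> t" using assms(1) t .
      have "96 \<le> c * sqrt (ln (real l))" using l c by (simp add: pos_divide_le_eq mult.commute)
      then have "96 / sqrt (\<nu> t) \<le> c * sqrt (ln (real l)) / sqrt (\<nu> t)"
        using v by (intro divide_right_mono) auto
      also have "\<dots> \<le> c * \<bar>sqrt (ln (real l)) / sqrt (\<nu> t)\<bar>"
        using c mult_left_mono[OF abs_ge_self, of c "sqrt (ln (real l)) / sqrt (\<nu> t)"] by simp
      finally show "norm (case p of (l, t) \<Rightarrow> 96 / sqrt (\<nu> t)) \<le> c * norm (case p of (l, t) \<Rightarrow> sqrt (ln (real l) / \<nu> t))"
        using v by (simp add: p real_sqrt_divide)
    qed
  qed
  have meas_Z: "(\<integral>z. std_normal_density z * h z \<partial>lborel) = (\<integral>\<omega>. h (Z \<omega>) \<partial>M')"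
    if "1-lipschitz_on UNIV h" for h :: "real \<Rightarrow> real"
    using assms(6) borel_measurable_continuous_onI[OF lipschitz_on_continuous_on[OF that]]
    by (intro distributed_integral) auto
  have bound: "wasserstein_dist M (poisson_wave (\<nu> t) (N t) l x) M' Z
      \<le> ereal ((sqrt 3 / (2 * pi\<^sup>2) + 2 / 3 * sqrt (3 / (2 * pi ^ 3))) * sqrt (ln (real l) / \<nu> t) + ?R (l, t))"
    if t: "0 < t" and l: "0 < l" and x: "x \<in> sphere 0 1" for l t x
  proof -
    have v: "0 < \<nu> t" using assms(1) t .
    have "wasserstein_dist M (poisson_wave (\<nu> t) (N t) l x) M' Z \<le> ereal (96 / sqrt (\<nu> t))"
      unfolding wasserstein_dist_def
    proof (rule SUP_least)
      fix h :: "real \<Rightarrow> real" assume "h \<in> {h. 1-lipschitz_on UNIV h}"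
      then have h: "1-lipschitz_on UNIV h" by simp
      show "ereal \<bar>(\<integral>\<omega>. h (poisson_wave (\<nu> t) (N t) l x \<omega>) \<partial>M) - (\<integral>\<omega>. h (Z \<omega>) \<partial>M')\<bar> \<le> ereal (96 / sqrt (\<nu> t))"
        using poisson_wave_lipschitz_bound[OF assms(4)[OF t] v l _ h, of x] x by (simp add: meas_Z[OF h])
    qed
    \<comment> \<open>The leading term is nonnegative because \<open>l \<ge> 1\<close>, so it can be
      added on the right.\<close>
    also have "96 / sqrt (\<nu> t) \<le> (sqrt 3 / (2 * pi\<^sup>2) + 2 / 3 * sqrt (3 / (2 * pi ^ 3))) * sqrt (ln (real l) / \<nu> t)
        + 96 / sqrt (\<nu> t)"
      using v l by (simp add: ln_ge_zero)
    finally show ?thesis by simp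
  qed
  have "\<forall>\<^sub>F p in (at_top :: nat filter) \<times>\<^sub>F (at_top :: real filter). 0 < fst p \<and> 0 < snd p"
    by (intro eventually_prodI eventually_gt_at_top)
  then show "\<forall>\<^sub>F (l, t) in at_top \<times>\<^sub>F at_top. \<forall>x \<in> sphere 0 1.
      wasserstein_dist M (poisson_wave (\<nu> t) (N t) l x) M' Z
        \<le> ereal ((sqrt 3 / (2 * pi\<^sup>2) + 2 / 3 * sqrt (3 / (2 * pi ^ 3))) * sqrt (ln (real l) / \<nu> t) + ?R (l, t))"
    by (rule eventually_mono) (use bound in auto)
qed

end
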